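(* Let $G$ be a finitely generated virtually nilpotent group, and let $\varphi$ be an equation (in any finite number of variables) over $G$. Let $M$ be a sequence of probability measures on $G$ that measures index uniformly. Let $H_1>H_2>\cdots$ be a sequence of finite-index normal subgroups of $G$ such that $\bigcap_{m=1}^\infty H_m=\{1\}$. Then $\mathrm{d}\varphi(G/H_m)\to\mathrm{d}\varphi_M(G)$ as $m\to\infty$.
   Context: Groups are discrete. Write $F_k$ for the free group on generators $x_1,\ldots,x_k$. An equation in $k$ variables over $G$ is a word $\varphi\in F_k\ast G$ (free product), viewed as a function $G^k\to G$ by letting $\varphi(g_1,\ldots,g_k)$ be the element of $G$ obtained by replacing each instance of $x_i$ in $\varphi$ by $g_i$. For a normal subgroup $H\lhd G$, $\varphi$ is also regarded as an equation over $G/H$ by replacing its constants from $G$ by their images in $G/H$. For a probability measure $\mu$ on $G$, $\mathrm{d}\varphi_\mu(G)$ is the probability that $\varphi(g_1,\ldots,g_k)=1$ when $g_1,\ldots,g_k$ are chosen independently according to $\mu$. For a sequence $M=(\mu_n)_{n=1}^\infty$ of probability measures, $\mathrm{d}\varphi_M(G)=\limsup_{n\to\infty}\mathrm{d}\varphi_{\mu_n}(G)$. For a finite group $Q$, $\mathrm{d}\varphi(Q)$ denotes $\mathrm{d}\varphi_\mu(Q)$ with $\mu$ the uniform probability measure on $Q$. The sequence $M$ measures index uniformly if $\mu_n(xH)\to1/[G:H]$ as $n\to\infty$, uniformly over all $x\in G$ and all subgroups $H$ of $G$, where $1/[G:H]=0$ if $[G:H]=\infty$. *)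

theory Defs
  imports "HOL-Algebra.Algebra" "HOL-Probability.Probability"
begin

section \<open>Group-theoretic notions\<close>

definition finitely_generated_group :: "('a, 'b) monoid_scheme \<Rightarrow> bool" where
  "finitely_generated_group G \<longleftrightarrow>
     group G \<and> (\<exists>S. finite S \<and> S \<subseteq> carrier G \<and> generate G S = carrier G)"

primrec lower_central_series :: "('a, 'b) monoid_scheme \<Rightarrow> nat \<Rightarrow> 'a set" where
  "lower_central_series G 0 = carrier G"
| "lower_central_series G (Suc n) =
     generate G {x \<otimes>\<^bsub>G\<^esub> y \<otimes>\<^bsub>G\<^esub> inv\<^bsub>G\<^esub> x \<otimes>\<^bsub>G\<^esub> inv\<^bsub>G\<^esub> y | x y.
       x \<in> lower_central_series G n \<and> y \<in> carrier G}"

definition nilpotent_group :: "('a, 'b) monoid_scheme \<Rightarrow> bool" where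
  "nilpotent_group G \<longleftrightarrow> group G \<and> (\<exists>n. lower_central_series G n = {\<one>\<^bsub>G\<^esub>})"

definition finite_index :: "('a, 'b) monoid_scheme \<Rightarrow> 'a set \<Rightarrow> bool" where
  "finite_index G H \<longleftrightarrow> subgroup H G \<and> finite (rcosets\<^bsub>G\<^esub> H)"

definition virtually_nilpotent_group :: "('a, 'b) monoid_scheme \<Rightarrow> bool" where
  "virtually_nilpotent_group G \<longleftrightarrow>
     group G \<and> (\<exists>N. finite_index G N \<and> nilpotent_group (G\<lparr>carrier := N\<rparr>))"

definition inverse_index :: "('a, 'b) monoid_scheme \<Rightarrow> 'a set \<Rightarrow> real" where
  "inverse_index G H =
     (if finite (rcosets\<^bsub>G\<^esub> H) then 1 / real (card (rcosets\<^bsub>G\<^esub> H)) else 0)"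


section \<open>The free product of a free group with a group\<close>

text \<open>
  The free product of the free group on \<open>x\<^sub>0, \<dots>, x\<^bsub>k-1\<^esub>\<close> with \<open>G\<close> is realised as the
  set of words in the letters \<open>x\<^sub>i\<close>, \<open>x\<^sub>i\<close> inverse, and elements of \<open>G\<close>, modulo free cancellation
  of the variables and the multiplication table of \<open>G\<close>.
\<close>

datatype 'a letter = Var nat | VarInv nat | Const 'a

definition letters :: "nat \<Rightarrow> ('a, 'b) monoid_scheme \<Rightarrow> 'a letter set" where
  "letters k G = Var ` {..<k} \<union> VarInv ` {..<k} \<union> Const ` carrier G"

inductive word_eq ::
    "nat \<Rightarrow> ('a, 'b) monoid_scheme \<Rightarrow> 'a letter list \<Rightarrow> 'a letter list \<Rightarrow> bool"
  for k G where
  refl: "w \<in> lists (letters k G) \<Longrightarrow> word_eq k G w w"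
| sym: "word_eq k G v w \<Longrightarrow> word_eq k G w v"
| trans: "word_eq k G u v \<Longrightarrow> word_eq k G v w \<Longrightarrow> word_eq k G u w"
| var_inv: "\<lbrakk>u \<in> lists (letters k G); v \<in> lists (letters k G); i < k\<rbrakk> \<Longrightarrow>
     word_eq k G (u @ [Var i, VarInv i] @ v) (u @ v)"
| inv_var: "\<lbrakk>u \<in> lists (letters k G); v \<in> lists (letters k G); i < k\<rbrakk> \<Longrightarrow>
     word_eq k G (u @ [VarInv i, Var i] @ v) (u @ v)"
| one: "\<lbrakk>u \<in> lists (letters k G); v \<in> lists (letters k G)\<rbrakk> \<Longrightarrow>
     word_eq k G (u @ [Const \<one>\<^bsub>G\<^esub>] @ v) (u @ v)"
| mult: "\<lbrakk>u \<in> lists (letters k G); v \<in> lists (letters k G);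
       a \<in> carrier G; b \<in> carrier G\<rbrakk> \<Longrightarrow>
     word_eq k G (u @ [Const a, Const b] @ v) (u @ [Const (a \<otimes>\<^bsub>G\<^esub> b)] @ v)"

definition word_class :: "nat \<Rightarrow> ('a, 'b) monoid_scheme \<Rightarrow> 'a letter list \<Rightarrow> 'a letter list set"
  where "word_class k G w = {v. word_eq k G w v}"

definition free_product :: "nat \<Rightarrow> ('a, 'b) monoid_scheme \<Rightarrow> 'a letter list set monoid" where
  "free_product k G =
     \<lparr>carrier = word_class k G ` lists (letters k G),
      monoid.mult = (\<lambda>A B. \<Union>u\<in>A. \<Union>v\<in>B. word_class k G (u @ v)),
      one = word_class k G []\<rparr>"


section \<open>Equations as functions\<close>

primrec eval_letter :: "('a, 'b) monoid_scheme \<Rightarrow> (nat \<Rightarrow> 'a) \<Rightarrow> 'a letter \<Rightarrow> 'a" where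
  "eval_letter G g (Var i) = g i"
| "eval_letter G g (VarInv i) = inv\<^bsub>G\<^esub> (g i)"
| "eval_letter G g (Const c) = c"

definition eval_word :: "('a, 'b) monoid_scheme \<Rightarrow> (nat \<Rightarrow> 'a) \<Rightarrow> 'a letter list \<Rightarrow> 'a" where
  "eval_word G g w = foldr (\<lambda>l x. eval_letter G g l \<otimes>\<^bsub>G\<^esub> x) w \<one>\<^bsub>G\<^esub>"

text \<open>
  All representatives of an element of the free product have the same value; see
  \<open>eval_equation_word_class\<close> below.
\<close>

definition eval_equation ::
    "('a, 'b) monoid_scheme \<Rightarrow> 'a letter list set \<Rightarrow> (nat \<Rightarrow> 'a) \<Rightarrow> 'a" where
  "eval_equation G \<phi> g = the_elem (eval_word G g ` \<phi>)"

text \<open>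
  The map of free products that fixes the variables and applies \<open>f : G \<rightarrow> K\<close> to the constants;
  see \<open>map_equation_word_class\<close> below.
\<close>

definition map_equation ::
    "nat \<Rightarrow> ('c, 'd) monoid_scheme \<Rightarrow> ('a \<Rightarrow> 'c) \<Rightarrow> 'a letter list set \<Rightarrow> 'c letter list set" where
  "map_equation k K f \<phi> = (\<Union>w\<in>\<phi>. word_class k K (map (map_letter f) w))"

definition quotient_equation ::
    "nat \<Rightarrow> ('a, 'b) monoid_scheme \<Rightarrow> 'a set \<Rightarrow> 'a letter list set \<Rightarrow> 'a set letter list set" where
  "quotient_equation k G H = map_equation k (G Mod H) (\<lambda>c. H #>\<^bsub>G\<^esub> c)"


section \<open>Degree of satisfiability\<close>

text \<open>
  The factors of the product measure below carry the full power set as sigma-algebra. For countable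
  groups, in particular finitely generated ones, every set of \<open>k\<close>-tuples is then measurable.
\<close>

definition prob_measure_on :: "('a, 'b) monoid_scheme \<Rightarrow> 'a measure \<Rightarrow> bool" where
  "prob_measure_on G \<mu> \<longleftrightarrow>
     prob_space \<mu> \<and> space \<mu> = carrier G \<and> sets \<mu> = Pow (carrier G)"

definition sat_degree ::
    "nat \<Rightarrow> ('a, 'b) monoid_scheme \<Rightarrow> 'a letter list set \<Rightarrow> 'a measure \<Rightarrow> real" where
  "sat_degree k G \<phi> \<mu> =
     measure (PiM {..<k} (\<lambda>_. \<mu>))
       {g \<in> {..<k} \<rightarrow>\<^sub>E carrier G. eval_equation G \<phi> g = \<one>\<^bsub>G\<^esub>}"

definition sat_degree_seq ::
    "nat \<Rightarrow> ('a, 'b) monoid_scheme \<Rightarrow> 'a letter list set \<Rightarrow> (nat \<Rightarrow> 'a measure) \<Rightarrow> ereal" where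
  "sat_degree_seq k G \<phi> M = limsup (\<lambda>n. ereal (sat_degree k G \<phi> (M n)))"

definition sat_degree_finite ::
    "nat \<Rightarrow> ('a, 'b) monoid_scheme \<Rightarrow> 'a letter list set \<Rightarrow> real" where
  "sat_degree_finite k Q \<phi> = sat_degree k Q \<phi> (uniform_count_measure (carrier Q))"

definition measures_index_uniformly ::
    "('a, 'b) monoid_scheme \<Rightarrow> (nat \<Rightarrow> 'a measure) \<Rightarrow> bool" where
  "measures_index_uniformly G M \<longleftrightarrow>
     uniform_limit {(x, H). x \<in> carrier G \<and> subgroup H G}
       (\<lambda>n (x, H). measure (M n) (x <#\<^bsub>G\<^esub> H)) (\<lambda>(x, H). inverse_index G H) sequentially"


section \<open>Well-definedness\<close>

lemma word_eq_in_lists: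
  assumes "group G" "word_eq k G u v"
  shows "u \<in> lists (letters k G) \<and> v \<in> lists (letters k G)"
proof -
  interpret group G by fact
  show ?thesis
    using assms(2) by (induction) (auto simp: letters_def)
qed

lemma word_class_eq_iff:
  assumes "u \<in> lists (letters k G)" "v \<in> lists (letters k G)"
  shows "word_class k G u = word_class k G v \<longleftrightarrow> word_eq k G u v"
proof
  show "word_eq k G u v" if "word_class k G u = word_class k G v"
    using that word_eq.refl[OF assms(2)] unfolding word_class_def by blast
  show "word_class k G u = word_class k G v" if "word_eq k G u v"
    unfolding word_class_def
    using word_eq.trans[OF that] word_eq.trans[OF word_eq.sym[OF that]] by blast
qed

lemma word_eq_append_left:
  assumes "word_eq k G u v" "w \<in> lists (letters k G)"
  shows "word_eq k G (w @ u) (w @ v)"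
  using assms
proof induction
  case (var_inv u v i)
  then show ?case using word_eq.var_inv[of "w @ u" k G v i] by simp
next
  case (inv_var u v i)
  then show ?case using word_eq.inv_var[of "w @ u" k G v i] by simp
next
  case (one u v)
  then show ?case using word_eq.one[of "w @ u" k G v] by simp
next
  case (mult u v a b)
  then show ?case using word_eq.mult[of "w @ u" k G v a b] by simp
next
  case (refl v)
  then show ?case by (simp add: word_eq.refl)
next
  case (sym u v)
  then show ?case using word_eq.sym by blast
next
  case (trans u v z)
  then show ?case by (blast intro: word_eq.trans)
qed

lemma word_eq_append_right:
  assumes "word_eq k G u v" "w \<in> lists (letters k G)"
  shows "word_eq k G (u @ w) (v @ w)"
  using assms
proof induction
  case (var_inv u v i)
  then show ?case using word_eq.var_inv[of u k G "v @ w" i] by simp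
next
  case (inv_var u v i)
  then show ?case using word_eq.inv_var[of u k G "v @ w" i] by simp
next
  case (one u v)
  then show ?case using word_eq.one[of u k G "v @ w"] by simp
next
  case (mult u v a b)
  then show ?case using word_eq.mult[of u k G "v @ w" a b] by simp
next
  case (refl v)
  then show ?case by (simp add: word_eq.refl)
next
  case (sym u v)
  then show ?case using word_eq.sym by blast
next
  case (trans u v z)
  then show ?case by (blast intro: word_eq.trans)
qed

lemma word_eq_append:
  assumes "group G" "word_eq k G u u'" "word_eq k G v v'"
  shows "word_eq k G (u @ v) (u' @ v')"
  using word_eq.trans[OF word_eq_append_right[OF assms(2)] word_eq_append_left[OF assms(3)]]
    word_eq_in_lists[OF assms(1)] assms(2,3) by blast

lemma free_product_mult_word_class:
  assumes "group G" "u \<in> lists (letters k G)" "v \<in> lists (letters k G)"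
  shows "word_class k G u \<otimes>\<^bsub>free_product k G\<^esub> word_class k G v = word_class k G (u @ v)"
proof -
  have "word_class k G (u' @ v') = word_class k G (u @ v)"
    if "u' \<in> word_class k G u" "v' \<in> word_class k G v" for u' v'
  proof -
    have *: "word_eq k G (u @ v) (u' @ v')"
      using that assms(1) by (simp add: word_class_def word_eq_append)
    show ?thesis
      using word_class_eq_iff[of "u @ v" k G "u' @ v'"] * word_eq_in_lists[OF assms(1) *] by simp
  qed
  moreover have "u \<in> word_class k G u" "v \<in> word_class k G v"
    using assms by (auto simp: word_class_def intro: word_eq.refl)
  ultimately show ?thesis
    unfolding free_product_def monoid.simps by (intro equalityI UN_least UN_upper) blast+
qed

primrec inv_letter :: "('a, 'b) monoid_scheme \<Rightarrow> 'a letter \<Rightarrow> 'a letter" where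
  "inv_letter G (Var i) = VarInv i"
| "inv_letter G (VarInv i) = Var i"
| "inv_letter G (Const c) = Const (inv\<^bsub>G\<^esub> c)"

lemma word_eq_inverse:
  assumes "group G" "w \<in> lists (letters k G)"
  shows "\<exists>v \<in> lists (letters k G). word_eq k G (v @ w) []"
  using assms(2)
proof induction
  case Nil
  show ?case by (rule bexI[of _ "[]"]) (simp_all add: word_eq.refl)
next
  case (Cons l w)
  interpret group G by fact
  obtain v where v: "v \<in> lists (letters k G)" "word_eq k G (v @ w) []"
    using Cons by blast
  have l: "inv_letter G l \<in> letters k G"
    using Cons(1) by (auto simp: letters_def)
  have "word_eq k G (v @ [inv_letter G l, l] @ w) (v @ w)"
  proof (cases l)
    case (Var i)
    then show ?thesis using Cons v word_eq.inv_var[of v k G w i] by (auto simp: letters_def)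
  next
    case (VarInv i)
    then show ?thesis using Cons v word_eq.var_inv[of v k G w i] by (auto simp: letters_def)
  next
    case (Const c)
    then have c: "c \<in> carrier G" using Cons by (auto simp: letters_def)
    have "word_eq k G (v @ [Const (inv\<^bsub>G\<^esub> c), Const c] @ w) (v @ [Const (inv\<^bsub>G\<^esub> c \<otimes>\<^bsub>G\<^esub> c)] @ w)"
      using c v Cons by (intro word_eq.mult) auto
    then have "word_eq k G (v @ [Const (inv\<^bsub>G\<^esub> c), Const c] @ w) (v @ [Const \<one>\<^bsub>G\<^esub>] @ w)"
      using c by simp
    then show ?thesis
      using word_eq.trans[OF _ word_eq.one[OF v(1) Cons(2)]] Const by simp
  qed
  then have "word_eq k G ((v @ [inv_letter G l]) @ l # w) []"
    using word_eq.trans[OF _ v(2)] by simp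
  then show ?case
    using v l by (intro bexI[of _ "v @ [inv_letter G l]"]) auto
qed

lemma group_free_product:
  assumes "group G"
  shows "group (free_product k G)"
proof (rule groupI)
  let ?F = "free_product k G"
  have carr: "carrier ?F = word_class k G ` lists (letters k G)"
    and one: "\<one>\<^bsub>?F\<^esub> = word_class k G []"
    by (simp_all add: free_product_def)
  note mult = free_product_mult_word_class[OF assms, unfolded in_lists_conv_set]
  show "\<one>\<^bsub>?F\<^esub> \<in> carrier ?F" by (auto simp: carr one)
  show "x \<otimes>\<^bsub>?F\<^esub> y \<in> carrier ?F" if "x \<in> carrier ?F" "y \<in> carrier ?F" for x y
    using that by (auto simp: carr mult intro!: imageI)
  show "x \<otimes>\<^bsub>?F\<^esub> y \<otimes>\<^bsub>?F\<^esub> z = x \<otimes>\<^bsub>?F\<^esub> (y \<otimes>\<^bsub>?F\<^esub> z)"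
    if xyz: "x \<in> carrier ?F" "y \<in> carrier ?F" "z \<in> carrier ?F" for x y z
  proof -
    obtain u v w where "u \<in> lists (letters k G)" "v \<in> lists (letters k G)"
        "w \<in> lists (letters k G)"
      and "x = word_class k G u" "y = word_class k G v" "z = word_class k G w"
      using xyz unfolding carr by blast
    then show ?thesis
      by (simp add: free_product_mult_word_class[OF assms])
  qed
  show "\<one>\<^bsub>?F\<^esub> \<otimes>\<^bsub>?F\<^esub> x = x" if "x \<in> carrier ?F" for x
    using that by (auto simp: carr one mult)
  show "\<exists>y\<in>carrier ?F. y \<otimes>\<^bsub>?F\<^esub> x = \<one>\<^bsub>?F\<^esub>" if x: "x \<in> carrier ?F" for x
  proof -
    obtain w where w: "w \<in> lists (letters k G)" "x = word_class k G w"
      using x unfolding carr by blast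
    obtain v where v: "v \<in> lists (letters k G)" "word_eq k G (v @ w) []"
      using word_eq_inverse[OF assms w(1)] by blast
    have "word_class k G (v @ w) = word_class k G []"
      using v w by (subst word_class_eq_iff) auto
    then show ?thesis
      using v w by (intro bexI[of _ "word_class k G v"]) (auto simp: carr one mult)
  qed
qed

lemma eval_letter_closed:
  assumes "group G" "g \<in> {..<k} \<rightarrow> carrier G" "l \<in> letters k G"
  shows "eval_letter G g l \<in> carrier G"
proof -
  interpret group G by fact
  show ?thesis using assms by (auto simp: letters_def Pi_iff)
qed

lemma eval_word_closed:
  assumes "group G" "g \<in> {..<k} \<rightarrow> carrier G" "w \<in> lists (letters k G)"
  shows "eval_word G g w \<in> carrier G"
proof -
  interpret group G by fact
  show ?thesis
    using assms(3) by induction (auto simp: eval_word_def eval_letter_closed[OF assms(1,2)])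
qed

lemma eval_word_append:
  assumes "group G" "g \<in> {..<k} \<rightarrow> carrier G"
    "u \<in> lists (letters k G)" "v \<in> lists (letters k G)"
  shows "eval_word G g (u @ v) = eval_word G g u \<otimes>\<^bsub>G\<^esub> eval_word G g v"
proof -
  interpret group G by fact
  have v: "eval_word G g v \<in> carrier G"
    using assms eval_word_closed by blast
  show ?thesis
    using assms(3)
  proof induction
    case Nil
    then show ?case using v by (simp add: eval_word_def)
  next
    case (Cons l u)
    have "eval_word G g u \<in> carrier G" "eval_letter G g l \<in> carrier G"
      using Cons assms eval_word_closed eval_letter_closed by blast+
    then show ?case using Cons v by (simp add: eval_word_def m_assoc)
  qed
qed

lemma eval_word_cong:
  assumes "group G" "g \<in> {..<k} \<rightarrow> carrier G" "word_eq k G u v"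
  shows "eval_word G g u = eval_word G g v"
proof -
  interpret group G by fact
  have app: "eval_word G g (u @ m @ v) = eval_word G g (u @ m' @ v)"
    if "u \<in> lists (letters k G)" "v \<in> lists (letters k G)"
      "m \<in> lists (letters k G)" "m' \<in> lists (letters k G)"
      "eval_word G g m = eval_word G g m'" for u v m m'
  proof -
    have "m @ v \<in> lists (letters k G)" "m' @ v \<in> lists (letters k G)"
      using that by (simp_all only: append_in_lists_conv)
    then show ?thesis
      using that by (simp only: eval_word_append[OF assms(1,2)])
  qed
  show ?thesis
    using assms(3)
  proof induction
    case (var_inv u v i)
    have "g i \<in> carrier G" using var_inv assms by auto
    then show ?case using app[of u v "[Var i, VarInv i]" "[]"] var_inv
      by (simp add: eval_word_def letters_def)
  next
    case (inv_var u v i)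
    have "g i \<in> carrier G" using inv_var assms by auto
    then show ?case using app[of u v "[VarInv i, Var i]" "[]"] inv_var
      by (simp add: eval_word_def letters_def)
  next
    case (one u v)
    then show ?case using app[of u v "[Const \<one>\<^bsub>G\<^esub>]" "[]"]
      by (simp add: eval_word_def letters_def)
  next
    case (mult u v a b)
    then show ?case using app[of u v "[Const a, Const b]" "[Const (a \<otimes>\<^bsub>G\<^esub> b)]"]
      by (simp add: eval_word_def letters_def)
  qed auto
qed

lemma eval_equation_word_class:
  assumes "group G" "g \<in> {..<k} \<rightarrow> carrier G" "w \<in> lists (letters k G)"
  shows "eval_equation G (word_class k G w) g = eval_word G g w"
proof -
  have "eval_word G g ` word_class k G w = {eval_word G g w}"
  proof (intro equalityI subsetI)
    fix x assume "x \<in> eval_word G g ` word_class k G w"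
    then show "x \<in> {eval_word G g w}"
      using eval_word_cong[OF assms(1,2), of w] by (auto simp: word_class_def)
  next
    fix x assume "x \<in> {eval_word G g w}"
    then show "x \<in> eval_word G g ` word_class k G w"
      using word_eq.refl[OF assms(3)] by (auto simp: word_class_def)
  qed
  then show ?thesis by (simp add: eval_equation_def)
qed

lemma map_letter_in_letters:
  assumes "f \<in> carrier G \<rightarrow> carrier K" "w \<in> lists (letters k G)"
  shows "map (map_letter f) w \<in> lists (letters k K)"
  using assms(2,1) by induction (auto simp: letters_def)

lemma map_equation_word_class:
  assumes "group G" "group K" "f \<in> hom G K" "w \<in> lists (letters k G)"
  shows "map_equation k K f (word_class k G w) = word_class k K (map (map_letter f) w)"
proof -
  interpret group_hom G K f
    using assms by (simp add: group_hom_def group_hom_axioms_def)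
  have f: "f \<in> carrier G \<rightarrow> carrier K" by auto
  note ml = map_letter_in_letters[OF f]
  have cong: "word_eq k K (map (map_letter f) u) (map (map_letter f) v)"
    if "word_eq k G u v" for u v
    using that
  proof induction
    case (refl w)
    then show ?case using ml word_eq.refl by blast
  next
    case (sym v w)
    then show ?case by (rule_tac word_eq.sym)
  next
    case (trans u v w)
    then show ?case by (rule_tac word_eq.trans)
  next
    case (var_inv u v i)
    then show ?case using word_eq.var_inv[OF ml ml] by fastforce
  next
    case (inv_var u v i)
    then show ?case using word_eq.inv_var[OF ml ml] by fastforce
  next
    case (one u v)
    then show ?case using word_eq.one[OF ml ml] by fastforce
  next
    case (mult u v a b)
    then show ?case using word_eq.mult[OF ml[of u] ml[of v], where a = "f a" and b = "f b"] by simp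
  qed
  have "word_class k K (map (map_letter f) v) = word_class k K (map (map_letter f) w)"
    if "v \<in> word_class k G w" for v
  proof -
    have vw: "word_eq k K (map (map_letter f) v) (map (map_letter f) w)"
      using that by (intro word_eq.sym[OF cong]) (simp add: word_class_def)
    show ?thesis
      using word_class_eq_iff word_eq_in_lists[OF assms(2) vw] vw by blast
  qed
  moreover have "w \<in> word_class k G w"
    using assms by (auto simp: word_class_def intro: word_eq.refl)
  ultimately show ?thesis
    unfolding map_equation_def by blast
qed

lemma quotient_equation_in_carrier:
  assumes "H \<lhd> G" "\<phi> \<in> carrier (free_product k G)"
  shows "quotient_equation k G H \<phi> \<in> carrier (free_product k (G Mod H))"
proof -
  interpret normal H G by fact
  have hom: "(\<lambda>c. H #>\<^bsub>G\<^esub> c) \<in> hom G (G Mod H)"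
    by (rule r_coset_hom_Mod)
  have "\<phi> \<in> word_class k G ` lists (letters k G)"
    using assms(2) by (simp add: free_product_def)
  then obtain w where w: "w \<in> lists (letters k G)" "\<phi> = word_class k G w"
    by blast
  have "map (map_letter (\<lambda>c. H #>\<^bsub>G\<^esub> c)) w \<in> lists (letters k (G Mod H))"
    using hom by (intro map_letter_in_letters[OF _ w(1)]) (auto simp: hom_def)
  then show ?thesis
    unfolding quotient_equation_def w(2)
      map_equation_word_class[OF is_group factorgroup_is_group hom w(1)]
    by (simp add: free_product_def)
qed

end

theory Submission
  imports Defs
begin

text \<open>
  Let \<open>d m\<close> be the degree of satisfiability in \<open>G/H m\<close>, a decreasing sequence with limit \<open>D\<close>. Measuring
  index uniformly gives every union of cosets of \<open>(H m)\<^sup>k\<close> its expected density in the limit, so the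
  solution set has limit superior at most \<open>d m\<close> for every \<open>m\<close>. For the converse, \<open>H m / H m'\<close> is
  nilpotent of bounded class once \<open>m\<close> is large, and on a coset of \<open>(H m)\<^sup>k\<close> the equation modulo
  \<open>H m'\<close> is a polynomial map of bounded degree into a nilpotent group. Such a map is identically
  trivial as soon as it is trivial outside a set of density less than \<open>2\<^sup>-\<^sup>n\<close>. Hence a coset of
  \<open>(H m)\<^sup>k\<close> that solves the equation modulo \<open>H m\<close> either consists of solutions or loses a
  proportion at least \<open>2\<^sup>-\<^sup>n\<close> when passing to some \<open>H m'\<close>. The total loss is at most \<open>d m - D\<close>, so
  cosets consisting of solutions have density at least \<open>d m - 2\<^sup>n (d m - D)\<close>, which tends to \<open>D\<close>.
\<close>

section \<open>Commutators and filtrations\<close>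

definition commutator :: "('a, 'b) monoid_scheme \<Rightarrow> 'a \<Rightarrow> 'a \<Rightarrow> 'a" where
  "commutator G x y = x \<otimes>\<^bsub>G\<^esub> y \<otimes>\<^bsub>G\<^esub> inv\<^bsub>G\<^esub> x \<otimes>\<^bsub>G\<^esub> inv\<^bsub>G\<^esub> y"

context group
begin

text \<open>Together with \<open>m_assoc\<close> and \<open>inv_mult_group\<close> these rules bring
  a group word to right-nested reduced form, so that \<open>simp\<close> settles free-group
  identities as large as the Hall--Witt identity.\<close>

lemma inv_mult_cancel [simp]:
  assumes "x \<in> carrier G" "y \<in> carrier G"
  shows "inv x \<otimes> (x \<otimes> y) = y" "x \<otimes> (inv x \<otimes> y) = y"
  using assms by (simp_all add: m_assoc[symmetric])

lemmas group_word_simps = m_assoc inv_mult_group commutator_def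

lemma commutator_closed [simp]:
  "x \<in> carrier G \<Longrightarrow> y \<in> carrier G \<Longrightarrow> commutator G x y \<in> carrier G"
  by (simp add: commutator_def)

lemma inv_commutator:
  "x \<in> carrier G \<Longrightarrow> y \<in> carrier G \<Longrightarrow> inv (commutator G x y) = commutator G y x"
  by (simp add: group_word_simps)

end

text \<open>\<open>K 0\<close> may be smaller than the group: in the application only a finite-index
  subgroup is nilpotent, and the filtration starts at its image. The case \<open>i = 0\<close> of
  \<open>K_commutator\<close> says that \<open>K 0\<close> normalises every
  \<open>K j\<close>.\<close>

locale group_filtration = group G for G (structure) +
  fixes K :: "nat \<Rightarrow> 'a set"
  assumes K_subgroup: "subgroup (K i) G"
    and K_Suc_subset: "K (Suc i) \<subseteq> K i"
    and K_commutator: "x \<in> K i \<Longrightarrow> y \<in> K j \<Longrightarrow> commutator G x y \<in> K (i + j)"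
begin

lemma K_antimono: "i \<le> j \<Longrightarrow> K j \<subseteq> K i"
  by (rule lift_Suc_antimono_le[of K]) (rule K_Suc_subset)

lemma K_closed: "x \<in> K i \<Longrightarrow> x \<in> carrier G"
  using subgroup.mem_carrier[OF K_subgroup] .

lemma one_K [simp]: "\<one> \<in> K i"
  using subgroup.one_closed[OF K_subgroup] .

lemma mult_K: "x \<in> K i \<Longrightarrow> y \<in> K i \<Longrightarrow> x \<otimes> y \<in> K i"
  using subgroup.m_closed[OF K_subgroup] .

lemma inv_K: "x \<in> K i \<Longrightarrow> inv x \<in> K i"
  using subgroup.m_inv_closed[OF K_subgroup] .

end


section \<open>Polynomial maps between groups\<close>

text \<open>The multiplicative discrete derivative in direction \<open>t\<close>. Polynomial maps in
  the sense of Leibman are those whose iterated derivatives descend the filtration step by step; as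
  this condition has no base case, it is coinductive.\<close>

definition difference ::
    "('y, 'c) monoid_scheme \<Rightarrow> ('a, 'b) monoid_scheme \<Rightarrow> 'y \<Rightarrow> ('y \<Rightarrow> 'a) \<Rightarrow> 'y \<Rightarrow> 'a" where
  "difference Y G t f = (\<lambda>x. inv\<^bsub>G\<^esub> (f x) \<otimes>\<^bsub>G\<^esub> f (x \<otimes>\<^bsub>Y\<^esub> t))"

text \<open>
  The clause for the inverse makes closure under inversion immediate. For the usual definition it
  would have to be proved together with closure under products, where the induction on the
  filtration degree does not provide it.
\<close>

coinductive poly_map for Y :: "('y, 'c) monoid_scheme" and G :: "('a, 'b) monoid_scheme"
    and K :: "nat \<Rightarrow> 'a set" where
  "(\<And>x. x \<in> carrier Y \<Longrightarrow> f x \<in> K s) \<Longrightarrow>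
   (\<And>t. t \<in> carrier Y \<Longrightarrow> poly_map Y G K (Suc s) (difference Y G t f)) \<Longrightarrow>
   (\<And>t. t \<in> carrier Y \<Longrightarrow> poly_map Y G K (Suc s) (difference Y G t (\<lambda>x. inv\<^bsub>G\<^esub> (f x)))) \<Longrightarrow>
   poly_map Y G K s f"

lemma poly_mapD:
  assumes "poly_map Y G K s f"
  shows "x \<in> carrier Y \<Longrightarrow> f x \<in> K s"
    and "t \<in> carrier Y \<Longrightarrow> poly_map Y G K (Suc s) (difference Y G t f)"
    and "t \<in> carrier Y \<Longrightarrow> poly_map Y G K (Suc s) (difference Y G t (\<lambda>x. inv\<^bsub>G\<^esub> (f x)))"
  using assms by (auto elim: poly_map.cases)

text \<open>Group identities hold only at points of the carrier, so later rewriting of polynomial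
  maps passes through this lemma.\<close>

lemma poly_map_cong:
  assumes "monoid Y" "poly_map Y G K s f" "\<And>x. x \<in> carrier Y \<Longrightarrow> f x = f' x"
  shows "poly_map Y G K s f'"
proof -
  interpret Y: monoid Y by fact
  have "\<exists>f. poly_map Y G K s f \<and> (\<forall>x\<in>carrier Y. f x = f' x)"
    using assms by blast
  then show ?thesis
  proof (coinduction arbitrary: s f')
    case poly_map
    then obtain f where f: "poly_map Y G K s f" "\<And>x. x \<in> carrier Y \<Longrightarrow> f x = f' x"
      by blast
    have "f' x \<in> K s" if "x \<in> carrier Y" for x
      using poly_mapD(1)[OF f(1) that] f(2)[OF that] by simp
    moreover have "\<exists>g. poly_map Y G K (Suc s) g \<and> (\<forall>x\<in>carrier Y. g x = difference Y G t f' x)"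
      if "t \<in> carrier Y" for t
      using poly_mapD(2)[OF f(1) that] f(2) that
      by (intro exI[of _ "difference Y G t f"]) (auto simp: difference_def)
    moreover have "\<exists>g. poly_map Y G K (Suc s) g \<and>
        (\<forall>x\<in>carrier Y. g x = difference Y G t (\<lambda>x. inv\<^bsub>G\<^esub> (f' x)) x)"
      if "t \<in> carrier Y" for t
      using poly_mapD(3)[OF f(1) that] f(2) that
      by (intro exI[of _ "difference Y G t (\<lambda>x. inv\<^bsub>G\<^esub> (f x))"]) (auto simp: difference_def)
    ultimately show ?case by blast
  qed
qed

locale poly_maps = group_filtration G K + Y: group Y
  for G (structure) and K and Y :: "('y, 'c) monoid_scheme"
begin

section \<open>Elementary closure properties of polynomial maps\<close>

abbreviation "P \<equiv> poly_map Y G K"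

lemma poly_map_closed: "P s f \<Longrightarrow> x \<in> carrier Y \<Longrightarrow> f x \<in> carrier G"
  by (rule K_closed[OF poly_mapD(1)])

lemma poly_map_cong_on: "P s f \<Longrightarrow> (\<And>x. x \<in> carrier Y \<Longrightarrow> f x = f' x) \<Longrightarrow> P s f'"
  by (rule poly_map_cong[OF Y.monoid_axioms])

lemma poly_map_one: "P s (\<lambda>_. \<one>)"
  by (coinduction arbitrary: s) (auto simp: difference_def)

lemma poly_map_const:
  assumes "c \<in> K s"
  shows "P s (\<lambda>_. c)"
proof (rule poly_map.intros)
  show "P (Suc s) (difference Y G t (\<lambda>_. c))" "P (Suc s) (difference Y G t (\<lambda>_. inv c))" for t
    using poly_map_one[of "Suc s"] K_closed[OF assms] by (simp_all add: difference_def)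
qed (rule assms)

lemma poly_map_Suc: "P (Suc s) f \<Longrightarrow> P s f"
proof (coinduction arbitrary: s f)
  case poly_map
  then show ?case using poly_mapD[OF poly_map] K_Suc_subset[of s] by auto
qed

lemma poly_map_antimono: "i \<le> j \<Longrightarrow> P j f \<Longrightarrow> P i f"
  by (induction rule: inc_induct) (simp_all add: poly_map_Suc)

lemma poly_map_inv:
  assumes "P s f"
  shows "P s (\<lambda>x. inv (f x))"
proof (rule poly_map.intros)
  show "inv (f x) \<in> K s" if "x \<in> carrier Y" for x
    using poly_mapD(1)[OF assms that] by (rule inv_K)
  show "P (Suc s) (difference Y G t (\<lambda>x. inv (f x)))" if "t \<in> carrier Y" for t
    using poly_mapD(3)[OF assms that] .
  show "P (Suc s) (difference Y G t (\<lambda>x. inv (inv (f x))))" if "t \<in> carrier Y" for t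
    using poly_mapD(2)[OF assms that]
    by (rule poly_map_cong_on) (simp add: difference_def poly_map_closed[OF assms] that)
qed

text \<open>Maps of this shape are closed under differences: in direction \<open>t\<close> the
  constant \<open>c\<close> becomes the commutator of \<open>inv c\<close> and \<open>h t\<close>,
  one level deeper. They arise as differences of the inverse of a homomorphism.\<close>

lemma poly_map_hom_conj:
  assumes h: "h \<in> hom Y G" "\<And>x. x \<in> carrier Y \<Longrightarrow> h x \<in> K (Suc 0)" and "c \<in> K s"
  shows "P s (\<lambda>x. h x \<otimes> c \<otimes> inv (h x))"
proof -
  have hG: "h x \<in> carrier G" if "x \<in> carrier Y" for x
    using K_closed[OF h(2)[OF that]] .
  define f where "f = (\<lambda>x. h x \<otimes> c \<otimes> inv (h x))"
  have "\<exists>c\<in>K s. \<forall>x\<in>carrier Y. f x = h x \<otimes> c \<otimes> inv (h x)"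
    using assms(3) by (auto simp: f_def)
  then have "P s f"
  proof (coinduction arbitrary: s f)
    case poly_map
    then obtain c where c: "c \<in> K s" and f: "\<And>x. x \<in> carrier Y \<Longrightarrow> f x = h x \<otimes> c \<otimes> inv (h x)"
      by blast
    have cG: "c \<in> carrier G" using c by (rule K_closed)
    have "f x \<in> K s" if x: "x \<in> carrier Y" for x
    proof -
      have "commutator G (h x) c \<in> K s"
        using K_commutator[OF h(2)[OF x] c] K_Suc_subset[of s] by auto
      then have "commutator G (h x) c \<otimes> c \<in> K s"
        using c by (rule mult_K)
      then show ?thesis
        using hG[OF x] cG by (simp add: f[OF x] group_word_simps)
    qed
    moreover have "\<exists>c'\<in>K (Suc s). \<forall>x\<in>carrier Y. difference Y G t f x = h x \<otimes> c' \<otimes> inv (h x)"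
      if t: "t \<in> carrier Y" for t
    proof (intro bexI ballI)
      show "commutator G (inv c) (h t) \<in> K (Suc s)"
        using K_commutator[OF inv_K[OF c] h(2)[OF t]] by simp
      show "difference Y G t f x = h x \<otimes> commutator G (inv c) (h t) \<otimes> inv (h x)"
        if "x \<in> carrier Y" for x
        unfolding difference_def using that t hG[OF that] hG[OF t] cG
        by (simp add: f hom_mult[OF h(1)]) (simp add: group_word_simps)
    qed
    moreover have "\<exists>c'\<in>K (Suc s). \<forall>x\<in>carrier Y.
        difference Y G t (\<lambda>x. inv (f x)) x = h x \<otimes> c' \<otimes> inv (h x)"
      if t: "t \<in> carrier Y" for t
    proof (intro bexI ballI)
      show "commutator G c (h t) \<in> K (Suc s)"
        using K_commutator[OF c h(2)[OF t]] by simp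
      show "difference Y G t (\<lambda>x. inv (f x)) x = h x \<otimes> commutator G c (h t) \<otimes> inv (h x)"
        if "x \<in> carrier Y" for x
        unfolding difference_def using that t hG[OF that] hG[OF t] cG
        by (simp add: f hom_mult[OF h(1)]) (simp add: group_word_simps)
    qed
    ultimately show ?case by (intro exI conjI allI impI disjI1) (rule HOL.refl | blast)+
  qed
  then show ?thesis by (simp add: f_def)
qed

text \<open>The difference of \<open>h\<close> is the constant \<open>h t\<close>, known only to lie
  in \<open>K (Suc 0)\<close>; hence level 0, although \<open>h\<close> itself has values in
  \<open>K (Suc 0)\<close>. For the inverse of \<open>h\<close> the difference is a conjugated
  constant.\<close>

lemma poly_map_hom:
  assumes h: "h \<in> hom Y G" "\<And>x. x \<in> carrier Y \<Longrightarrow> h x \<in> K (Suc 0)"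
  shows "P 0 h"
proof (rule poly_map.intros)
  have hG: "h x \<in> carrier G" if "x \<in> carrier Y" for x
    using K_closed[OF h(2)[OF that]] .
  show "h x \<in> K 0" if "x \<in> carrier Y" for x
    using h(2)[OF that] K_Suc_subset[of 0] by blast
  show "P (Suc 0) (difference Y G t h)" if t: "t \<in> carrier Y" for t
  proof (rule poly_map_cong_on[OF poly_map_const[OF h(2)[OF t]]])
    show "h t = difference Y G t h x" if "x \<in> carrier Y" for x
      unfolding difference_def using that t hG[OF that] hG[OF t] by (simp add: hom_mult[OF h(1)])
  qed
  show "P (Suc 0) (difference Y G t (\<lambda>x. inv (h x)))" if t: "t \<in> carrier Y" for t
  proof (rule poly_map_cong_on[OF poly_map_hom_conj[OF h inv_K[OF h(2)[OF t]]]])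
    show "h x \<otimes> inv (h t) \<otimes> inv (h x) = difference Y G t (\<lambda>x. inv (h x)) x"
      if "x \<in> carrier Y" for x
      unfolding difference_def using that t hG[OF that] hG[OF t]
      by (simp add: hom_mult[OF h(1)] inv_mult_group m_assoc)
  qed
qed

lemma poly_map_trivial:
  assumes "K n = {\<one>}" "n \<le> s" "P s f" "x \<in> carrier Y"
  shows "f x = \<one>"
  using poly_mapD(1)[OF assms(3,4)] K_antimono[OF assms(2)] assms(1) by blast

text \<open>Leibman's theorem. Products and commutators need each other, so both are treated in one
  induction on \<open>n - s\<close>: the difference of either is built by products, conjugations and
  commutators whose levels exceed \<open>s\<close>, and from level \<open>n\<close> on everything is
  trivial.\<close>

lemma poly_map_mult_commutator:
  assumes "K n = {\<one>}"
  shows "(\<forall>f g. P s f \<longrightarrow> P s g \<longrightarrow> P s (\<lambda>x. f x \<otimes> g x)) \<and>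
    (\<forall>i j f g. i + j = s \<longrightarrow> P i f \<longrightarrow> P j g \<longrightarrow> P s (\<lambda>x. commutator G (f x) (g x)))"
proof (induction "n - s" arbitrary: s rule: less_induct)
  case less
  show ?case
  proof (cases "n \<le> s")
    case True
    have K1: "K s = {\<one>}" using K_antimono[OF True] assms one_K[of s] by blast
    have "P s (\<lambda>x. f x \<otimes> g x)" if "P s f" "P s g" for f g
      by (rule poly_map_cong_on[OF poly_map_one]) (simp add: poly_map_trivial[OF assms True] that)
    moreover have "P s (\<lambda>x. commutator G (f x) (g x))" if "i + j = s" "P i f" "P j g" for i j f g
    proof (rule poly_map_cong_on[OF poly_map_one])
      fix x assume "x \<in> carrier Y"
      then show "\<one> = commutator G (f x) (g x)"
        using K_commutator[OF poly_mapD(1)[OF that(2)] poly_mapD(1)[OF that(3)]] K1 that(1) by auto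
    qed
    ultimately show ?thesis by blast
  next
    case False
    have IH_mult: "P s' (\<lambda>x. f x \<otimes> g x)"
      if "s < s'" "P s' f" "P s' g" for s' f g
      using less[of s'] that False by auto
    have IH_comm: "P s' (\<lambda>x. commutator G (f x) (g x))"
      if "s < s'" "s' \<le> i + j" "P i f" "P j g" for s' f g i j
      using less[of "i + j"] that False by (intro poly_map_antimono[OF that(2)]) auto
    \<comment> \<open>A conjugate is a commutator times the original map, so conjugation by a map of
      any level preserves every level deeper than \<open>s\<close>.\<close>
    have conj: "P s' (\<lambda>x. g x \<otimes> f x \<otimes> inv (g x))"
      if "s < s'" "P s' f" "P i g" for s' i f g
    proof (rule poly_map_cong_on)
      show "P s' (\<lambda>x. commutator G (g x) (f x) \<otimes> f x)"
        by (rule IH_mult[OF that(1) IH_comm[OF that(1) _ that(3,2)] that(2)]) simp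
      show "commutator G (g x) (f x) \<otimes> f x = g x \<otimes> f x \<otimes> inv (g x)" if "x \<in> carrier Y" for x
        using poly_map_closed[OF \<open>P s' f\<close> that] poly_map_closed[OF \<open>P i g\<close> that] by (simp add: group_word_simps)
    qed
    have diff_mult: "P (Suc s) (difference Y G t (\<lambda>x. f x \<otimes> g x))"
      if f: "P s f" and g: "P s g" and t: "t \<in> carrier Y" for f g t
    proof (rule poly_map_cong_on)
      \<comment> \<open>Product rule: with f' and g' the differences of f and g, the difference of f
        g is (g^-1 f' g) g'.\<close>
      show "P (Suc s) (\<lambda>x. inv (g x) \<otimes> difference Y G t f x \<otimes> inv (inv (g x)) \<otimes> difference Y G t g x)"
        by (rule IH_mult[OF _ conj[OF _ poly_mapD(2)[OF f t] poly_map_inv[OF g]] poly_mapD(2)[OF g t]]) simp_all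
      show "inv (g x) \<otimes> difference Y G t f x \<otimes> inv (inv (g x)) \<otimes> difference Y G t g x =
          difference Y G t (\<lambda>x. f x \<otimes> g x) x" if "x \<in> carrier Y" for x
        using that t by (simp add: difference_def group_word_simps poly_map_closed[OF f] poly_map_closed[OF g])
    qed
    have mult: "P s (\<lambda>x. f x \<otimes> g x)" if f: "P s f" and g: "P s g" for f g
    proof (rule poly_map.intros)
      show "f x \<otimes> g x \<in> K s" if "x \<in> carrier Y" for x
        using that f g by (intro mult_K poly_mapD(1))
      fix t assume t: "t \<in> carrier Y"
      show "P (Suc s) (difference Y G t (\<lambda>x. f x \<otimes> g x))"
        using diff_mult[OF f g t] .
      \<comment> \<open>The inverse of the product is again a product of maps of level
        \<open>s\<close>, in reverse order, so the same rule covers it.\<close>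
      show "P (Suc s) (difference Y G t (\<lambda>x. inv (f x \<otimes> g x)))"
        using diff_mult[OF poly_map_inv[OF g] poly_map_inv[OF f] t]
        by (rule poly_map_cong_on) (simp add: difference_def inv_mult_group poly_map_closed[OF f] poly_map_closed[OF g] t)
    qed
    have diff_comm: "P (Suc s) (difference Y G t (\<lambda>x. commutator G (f x) (g x)))"
      if ij: "i + j = s" and f: "P i f" and g: "P j g" and t: "t \<in> carrier Y" for i j f g t
    proof (rule poly_map_cong_on)
      \<comment> \<open>With a and b the differences of f and g, [f,g]^-1 [f a, g b] = g (f [g^-1,a]
        [a,b] f^-1 [f,b]) g^-1. Every commutator on the right contains a or b, so its levels add up
        to more than \<open>s\<close>.\<close>
      let ?a = "difference Y G t f" and ?b = "difference Y G t g"
      note a = poly_mapD(2)[OF f t] and b = poly_mapD(2)[OF g t]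
      have "P (Suc s) (\<lambda>x. commutator G (inv (g x)) (?a x))"
        by (rule IH_comm[OF _ _ poly_map_inv[OF g] a]) (simp_all add: ij add.commute flip: ij)
      moreover have "P (Suc s) (\<lambda>x. commutator G (?a x) (?b x))"
        by (rule IH_comm[OF _ _ a b]) (simp_all flip: ij)
      ultimately have "P (Suc s) (\<lambda>x. f x \<otimes>
          (commutator G (inv (g x)) (?a x) \<otimes> commutator G (?a x) (?b x)) \<otimes> inv (f x))"
        by (intro conj[OF _ IH_mult f]) simp_all
      moreover have "P (Suc s) (\<lambda>x. commutator G (f x) (?b x))"
        by (rule IH_comm[OF _ _ f b]) (simp_all flip: ij)
      ultimately show "P (Suc s) (\<lambda>x. g x \<otimes>
          (f x \<otimes> (commutator G (inv (g x)) (?a x) \<otimes> commutator G (?a x) (?b x)) \<otimes> inv (f x) \<otimes>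
            commutator G (f x) (?b x)) \<otimes> inv (g x))"
        by (intro conj[OF _ IH_mult g]) simp_all
      show "g x \<otimes>
          (f x \<otimes> (commutator G (inv (g x)) (?a x) \<otimes> commutator G (?a x) (?b x)) \<otimes> inv (f x) \<otimes>
            commutator G (f x) (?b x)) \<otimes> inv (g x) =
          difference Y G t (\<lambda>x. commutator G (f x) (g x)) x" if "x \<in> carrier Y" for x
        using that t by (simp add: difference_def group_word_simps poly_map_closed[OF f] poly_map_closed[OF g])
    qed
    have "P s (\<lambda>x. commutator G (f x) (g x))"
      if ij: "i + j = s" and f: "P i f" and g: "P j g" for i j f g
    proof (rule poly_map.intros)
      show "commutator G (f x) (g x) \<in> K s" if "x \<in> carrier Y" for x
        using that f g ij K_commutator[of "f x" i "g x" j] by (auto intro: poly_mapD(1))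
      fix t assume t: "t \<in> carrier Y"
      show "P (Suc s) (difference Y G t (\<lambda>x. commutator G (f x) (g x)))"
        using diff_comm[OF ij f g t] .
      \<comment> \<open>Inverting a commutator exchanges its entries, hence \<open>diff_comm\<close>
        with the roles of \<open>f\<close> and \<open>g\<close> exchanged.\<close>
      have "P (Suc s) (difference Y G t (\<lambda>x. commutator G (g x) (f x)))"
        by (rule diff_comm[OF _ g f t]) (simp add: ij add.commute flip: ij)
      then show "P (Suc s) (difference Y G t (\<lambda>x. inv (commutator G (f x) (g x))))"
        by (rule poly_map_cong_on) (simp add: difference_def inv_commutator poly_map_closed[OF f] poly_map_closed[OF g] t)
    qed
    with mult show ?thesis by blast
  qed
qed

lemma poly_map_mult: "K n = {\<one>} \<Longrightarrow> P s f \<Longrightarrow> P s g \<Longrightarrow> P s (\<lambda>x. f x \<otimes> g x)"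
  using poly_map_mult_commutator by blast

text \<open>
  If \<open>f\<close> is trivial off a small set, then so is each difference of \<open>f\<close>; by induction all
  differences vanish, and \<open>f\<close> is constant.
\<close>

lemma poly_map_mostly_one:
  assumes "finite (carrier Y)" "K (s + n) = {\<one>}" "P s f"
    "card {y \<in> carrier Y. f y \<noteq> \<one>} * 2 ^ n < card (carrier Y)" "y \<in> carrier Y"
  shows "f y = \<one>"
  using assms(2-)
proof (induction n arbitrary: s f y)
  case 0
  then show ?case using poly_map_trivial[of s s f y] by simp
next
  case (Suc n)
  let ?B = "{y \<in> carrier Y. f y \<noteq> \<one>}"
  have diff: "difference Y G t f x = \<one>" if t: "t \<in> carrier Y" and x: "x \<in> carrier Y" for t x
  proof (rule Suc.IH[OF _ poly_mapD(2)[OF Suc.prems(2) t] _ x])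
    show "K (Suc s + n) = {\<one>}" using Suc.prems(1) by simp
    \<comment> \<open>The difference is nontrivial at \<open>y\<close> only if \<open>f\<close> is
      so at \<open>y\<close> or at its translate by \<open>t\<close>. The exceptional set at most
      doubles, which is the origin of the factor \<open>2 ^ n\<close>.\<close>
    let ?B' = "(\<lambda>y. y \<otimes>\<^bsub>Y\<^esub> inv\<^bsub>Y\<^esub> t) ` ?B"
    have "{y \<in> carrier Y. difference Y G t f y \<noteq> \<one>} \<subseteq> ?B \<union> ?B'"
    proof
      fix y assume y: "y \<in> {y \<in> carrier Y. difference Y G t f y \<noteq> \<one>}"
      have "y = y \<otimes>\<^bsub>Y\<^esub> t \<otimes>\<^bsub>Y\<^esub> inv\<^bsub>Y\<^esub> t" using y t by (simp add: Y.m_assoc)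
      moreover have "f y \<noteq> \<one> \<or> f (y \<otimes>\<^bsub>Y\<^esub> t) \<noteq> \<one>" using y by (auto simp: difference_def)
      ultimately show "y \<in> ?B \<union> ?B'" using y t by blast
    qed
    then have "card {y \<in> carrier Y. difference Y G t f y \<noteq> \<one>} \<le> card (?B \<union> ?B')"
      using assms(1) by (intro card_mono) auto
    also have "\<dots> \<le> card ?B + card ?B'" by (rule card_Un_le)
    also have "card ?B' \<le> card ?B" using assms(1) by (intro card_image_le) auto
    finally have "card {y \<in> carrier Y. difference Y G t f y \<noteq> \<one>} * 2 ^ n \<le> card ?B * 2 ^ Suc n"
      by simp
    then show "card {y \<in> carrier Y. difference Y G t f y \<noteq> \<one>} * 2 ^ n < card (carrier Y)"
      using Suc.prems(3) by linarith
  qed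
  have "card ?B \<noteq> card (carrier Y)"
    using Suc.prems(3) by auto
  then obtain z where z: "z \<in> carrier Y" "f z = \<one>"
    by (metis (mono_tags, lifting) Collect_cong Collect_mem_eq)
  \<comment> \<open>The chosen direction translates \<open>z\<close> to \<open>y\<close>, so a
    trivial difference gives \<open>f y = f z\<close>.\<close>
  have "difference Y G (inv\<^bsub>Y\<^esub> z \<otimes>\<^bsub>Y\<^esub> y) f z = \<one>"
    using z Suc.prems(4) by (intro diff) auto
  then show ?case
    using z Suc.prems(2,4) by (simp add: difference_def poly_map_closed)
qed

end

section \<open>The lower central series\<close>

context group
begin

lemma lower_central_series_normal: "lower_central_series G n \<lhd> G"
proof (induction n)
  case 0
  show ?case by (simp add: normal_inv_iff subgroup_self)
next
  case (Suc n)
  interpret L: normal "lower_central_series G n" G by fact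
  show ?case unfolding lower_central_series.simps
  proof (rule normal_generateI)
    show "{x \<otimes> y \<otimes> inv x \<otimes> inv y | x y. x \<in> lower_central_series G n \<and> y \<in> carrier G} \<subseteq> carrier G"
      by auto
    fix h g assume "h \<in> {x \<otimes> y \<otimes> inv x \<otimes> inv y | x y. x \<in> lower_central_series G n \<and> y \<in> carrier G}"
      and g: "g \<in> carrier G"
    then obtain x y where x: "x \<in> lower_central_series G n" and y: "y \<in> carrier G"
      and h: "h = x \<otimes> y \<otimes> inv x \<otimes> inv y" by blast
    let ?x = "g \<otimes> x \<otimes> inv g" and ?y = "g \<otimes> y \<otimes> inv g"
    have "g \<otimes> h \<otimes> inv g = ?x \<otimes> ?y \<otimes> inv ?x \<otimes> inv ?y"
      using x y g by (simp add: h group_word_simps)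
    moreover have "?x \<in> lower_central_series G n"
      using L.inv_op_closed2[OF g x] .
    moreover have "?y \<in> carrier G" using y g by simp
    ultimately show "g \<otimes> h \<otimes> inv g \<in>
        {x \<otimes> y \<otimes> inv x \<otimes> inv y | x y. x \<in> lower_central_series G n \<and> y \<in> carrier G}"
      by blast
  qed
qed

lemma lower_central_series_closed: "x \<in> lower_central_series G n \<Longrightarrow> x \<in> carrier G"
  using subgroup.mem_carrier[OF normal_imp_subgroup[OF lower_central_series_normal]] .

lemma normal_commutator_left:
  assumes "N \<lhd> G" "x \<in> N" "y \<in> carrier G"
  shows "commutator G x y \<in> N"
proof -
  interpret normal N G by fact
  have "x \<otimes> (y \<otimes> inv x \<otimes> inv y) \<in> N"
    using assms by (intro m_closed inv_op_closed2) auto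
  then show ?thesis
    using assms by (simp add: group_word_simps)
qed

lemma normal_commutator_right:
  assumes "N \<lhd> G" "x \<in> carrier G" "y \<in> N"
  shows "commutator G x y \<in> N"
proof -
  interpret normal N G by fact
  have "x \<otimes> y \<otimes> inv x \<otimes> inv y \<in> N"
    using assms by (intro m_closed inv_op_closed2) auto
  then show ?thesis by (simp add: commutator_def)
qed

lemma lower_central_series_Suc_subset:
  "lower_central_series G (Suc n) \<subseteq> lower_central_series G n"
  using normal_commutator_left[OF lower_central_series_normal]
  unfolding lower_central_series.simps commutator_def
  by (intro generate_subgroup_incl normal_imp_subgroup lower_central_series_normal) auto

lemma lower_central_series_commutator_carrier:
  assumes "x \<in> lower_central_series G n" "y \<in> carrier G"
  shows "commutator G x y \<in> lower_central_series G (Suc n)"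
  unfolding lower_central_series.simps commutator_def
  by (rule generate.incl) (use assms in blast)

text \<open>The induction step is the three subgroups lemma, a consequence of the Hall--Witt identity.\<close>

lemma lower_central_series_commutator:
  assumes "x \<in> lower_central_series G i" "y \<in> lower_central_series G j"
  shows "commutator G x y \<in> lower_central_series G (Suc (i + j))"
  using assms
proof (induction j arbitrary: i x y)
  case 0
  then show ?case
    using lower_central_series_commutator_carrier by simp
next
  case (Suc j)
  define N where "N = lower_central_series G (Suc (i + Suc j))"
  have N: "N \<lhd> G" unfolding N_def by (rule lower_central_series_normal)
  then interpret N: normal N G .
  have x: "x \<in> carrier G" using Suc.prems(1) by (rule lower_central_series_closed)
  let ?C = "{u \<otimes> v \<otimes> inv u \<otimes> inv v | u v. u \<in> lower_central_series G j \<and> v \<in> carrier G}"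
  have CG: "h \<in> carrier G" if hC: "h \<in> ?C" for h
  proof -
    obtain u v where "u \<in> lower_central_series G j" "v \<in> carrier G"
      and h: "h = u \<otimes> v \<otimes> inv u \<otimes> inv v"
      using hC by blast
    then have "u \<in> carrier G" "v \<in> carrier G" using lower_central_series_closed by blast+
    then show ?thesis by (simp add: h)
  qed
  have gen: "commutator G x h \<in> N" if hC: "h \<in> ?C" for h
  proof -
    obtain u v where u: "u \<in> lower_central_series G j" and v: "v \<in> carrier G"
      and h: "h = commutator G u v"
      using hC unfolding commutator_def by blast
    have uG: "u \<in> carrier G" using u by (rule lower_central_series_closed)
    note inv_closed = subgroup.m_inv_closed[OF normal_imp_subgroup[OF lower_central_series_normal]]
    have iu: "inv u \<in> lower_central_series G j" using u by (rule inv_closed)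
    have iv: "inv v \<in> carrier G" using v by blast
    have "commutator G x (inv v) \<in> lower_central_series G (Suc i)"
      using Suc.prems(1) iv by (rule lower_central_series_commutator_carrier)
    then have "inv (commutator G x (inv v)) \<in> lower_central_series G (Suc i)"
      by (rule inv_closed)
    then have 1: "commutator G (inv v) x \<in> lower_central_series G (Suc i)"
      using x v by (simp add: inv_commutator)
    \<comment> \<open>The induction hypothesis is applied with \<open>Suc i\<close> in place of
      \<open>i\<close>, which is why \<open>i\<close> is kept arbitrary.\<close>
    have A: "commutator G (commutator G (inv v) x) (inv u) \<in> N"
      using Suc.IH[OF 1 iu] by (simp only: N_def add_Suc add_Suc_right)
    have "commutator G (inv x) (inv u) \<in> lower_central_series G (Suc (i + j))"
      by (rule Suc.IH[OF inv_closed[OF Suc.prems(1)] iu])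
    then have B: "commutator G (commutator G (inv x) (inv u)) v \<in> N"
      using lower_central_series_commutator_carrier[OF _ v] by (simp only: N_def add_Suc_right)
    \<comment> \<open>The Hall--Witt identity, solved for \<open>commutator G x h\<close>, writes it
      as the conjugate by \<open>u\<close> of the product of \<open>?b\<close> and
      \<open>?a\<close>.\<close>
    let ?a = "v \<otimes> commutator G (commutator G (inv v) x) (inv u) \<otimes> inv v"
    let ?b = "x \<otimes> commutator G (commutator G (inv x) (inv u)) v \<otimes> inv x"
    have ab: "?a \<in> N" "?b \<in> N"
      using N.inv_op_closed2[OF v A] N.inv_op_closed2[OF x B] .
    have "commutator G x h = u \<otimes> (?b \<otimes> ?a) \<otimes> inv u"
      using x v uG unfolding h by (simp add: group_word_simps)
    also have "\<dots> \<in> N"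
      by (rule N.inv_op_closed2[OF uG N.m_closed[OF ab(2,1)]])
    finally show ?thesis .
  qed
  have "y \<in> generate G ?C" using Suc.prems(2) by simp
  \<comment> \<open>Membership passes from generators to inverses and products by commutator
    identities that introduce conjugates, which normality of \<open>N\<close> absorbs.\<close>
  then have "commutator G x y \<in> N"
  proof induction
    case one
    then show ?case using x N.one_closed by (simp add: commutator_def)
  next
    case (incl h)
    then show ?case by (rule gen)
  next
    case (inv h)
    have hG: "h \<in> carrier G" using CG[OF inv] .
    have "commutator G x (inv h) = inv h \<otimes> inv (commutator G x h) \<otimes> inv (inv h)"
      using x hG by (simp add: group_word_simps)
    also have "\<dots> \<in> N"
      using gen[OF inv] hG by (intro N.inv_op_closed2) auto
    finally show ?case .
  next
    case (eng h1 h2)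
    have hG: "h1 \<in> carrier G" "h2 \<in> carrier G"
      using eng generate_in_carrier[of ?C] CG by blast+
    have "commutator G x (h1 \<otimes> h2) = commutator G x h1 \<otimes> (h1 \<otimes> commutator G x h2 \<otimes> inv h1)"
      using x hG by (simp add: group_word_simps)
    also have "\<dots> \<in> N"
      using eng.IH hG by (intro N.m_closed N.inv_op_closed2) auto
    finally show ?case .
  qed
  then show ?case by (simp only: N_def)
qed

text \<open>Counted from 0, the commutator of terms \<open>i\<close> and \<open>j\<close> lies in
  term \<open>Suc (i + j)\<close>; the shift makes levels additive. Truncated subtraction makes
  levels 0 and 1 both the whole group, and commutators involving level 0 are covered by
  normality.\<close>

lemma lower_central_series_filtration:
  "group_filtration G (\<lambda>i. lower_central_series G (i - 1))"
proof (intro group_filtration.intro group_filtration_axioms.intro)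
  show "group G" ..
  fix i
  show "subgroup (lower_central_series G (i - 1)) G"
    by (rule normal_imp_subgroup[OF lower_central_series_normal])
  show "lower_central_series G (Suc i - 1) \<subseteq> lower_central_series G (i - 1)"
    using lower_central_series_Suc_subset[of "i - 1"] by (cases i) simp_all
  fix j x y
  assume xy: "x \<in> lower_central_series G (i - 1)" "y \<in> lower_central_series G (j - 1)"
  have G: "x \<in> carrier G" "y \<in> carrier G"
    using xy by (auto dest: lower_central_series_closed)
  show "commutator G x y \<in> lower_central_series G (i + j - 1)"
  proof (cases "i = 0 \<or> j = 0")
    case True
    then show ?thesis
      using xy G normal_commutator_left[OF lower_central_series_normal, of x "i - 1" y]
        normal_commutator_right[OF lower_central_series_normal, of x y "j - 1"] by auto
  next
    case False
    then have eq: "Suc (i - 1 + (j - 1)) = i + j - 1" by auto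
    show ?thesis
      using lower_central_series_commutator[OF xy] by (simp only: eq)
  qed
qed

end

text \<open>Carries the filtration of a nilpotent finite-index subgroup into a quotient of the whole
  group, where its image may be a proper subgroup.\<close>

lemma (in group_hom) filtration_image:
  assumes "group_filtration G K"
  shows "group_filtration H (\<lambda>i. h ` K i)"
proof -
  interpret K: group_filtration G K by fact
  show ?thesis
  proof (intro group_filtration.intro group_filtration_axioms.intro)
    show "group H" ..
    fix i
    show "subgroup (h ` K i) H"
      by (rule subgroup_img_is_subgroup[OF K.K_subgroup])
    show "h ` K (Suc i) \<subseteq> h ` K i"
      using K.K_Suc_subset by (rule image_mono)
    fix j x y assume "x \<in> h ` K i" "y \<in> h ` K j"
    then obtain u v where "u \<in> K i" "v \<in> K j" "x = h u" "y = h v" by blast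
    moreover from this have "commutator H x y = h (commutator G u v)"
      using K.K_closed by (simp add: commutator_def)
    ultimately show "commutator H x y \<in> h ` K (i + j)"
      using K.K_commutator by blast
  qed
qed

section \<open>Equations along cosets\<close>

lemma eval_word_Cons: "eval_word G g (l # w) = eval_letter G g l \<otimes>\<^bsub>G\<^esub> eval_word G g w"
  by (simp add: eval_word_def)

lemma eval_word_cong_fun:
  assumes "w \<in> lists (letters k G)" "\<And>i. i < k \<Longrightarrow> g i = g' i"
  shows "eval_word G g w = eval_word G g' w"
  using assms(1)
proof induction
  case (Cons l w)
  then show ?case
    using assms(2) by (cases l) (auto simp: eval_word_Cons letters_def)
qed (simp add: eval_word_def)

lemma (in group_hom) eval_word_map:
  assumes "g \<in> {..<k} \<rightarrow> carrier G" "w \<in> lists (letters k G)"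
  shows "eval_word H (\<lambda>i. h (g i)) (map (map_letter h) w) = h (eval_word G g w)"
  using assms(2)
proof induction
  case (Cons l w)
  have "eval_letter H (\<lambda>i. h (g i)) (map_letter h l) = h (eval_letter G g l)"
    using Cons.hyps(1) assms(1) by (auto simp: letters_def Pi_iff)
  then show ?case
    using Cons eval_letter_closed[OF G.is_group assms(1)] eval_word_closed[OF G.is_group assms(1)]
    by (simp add: eval_word_Cons)
qed (simp add: eval_word_def)

text \<open>Perturbing the arguments multiplies each letter by an error term. Moving the error to
  the right past the remaining word conjugates it by the value of that word, and the product of the
  conjugated errors is \<open>F\<close>.\<close>

lemma (in group_filtration) eval_word_poly_map:
  fixes Y :: "(nat \<Rightarrow> 'a) monoid"
  assumes A: "A \<lhd> G" "A \<subseteq> K (Suc 0)" and n: "K n = {\<one>}"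
    and Y: "Y = product_group {..<k} (\<lambda>_. G\<lparr>carrier := A\<rparr>)"
    and g: "g \<in> {..<k} \<rightarrow> carrier G" and w: "w \<in> lists (letters k G)"
  shows "\<exists>F. poly_map Y G K 0 F \<and> (\<forall>h\<in>carrier Y.
    eval_word G (\<lambda>i. g i \<otimes> h i) w = eval_word G g w \<otimes> F h)"
proof -
  interpret A: normal A G by fact
  have "group Y"
    using subgroup_imp_group[OF normal_imp_subgroup[OF A(1)]] by (simp add: Y)
  then interpret poly_maps G K Y
    by (rule poly_maps.intro[OF group_filtration_axioms])
  have hA: "h i \<in> A" if "h \<in> carrier Y" "i < k" for h i
    using that by (auto simp: Y)
  have gG: "g i \<in> carrier G" if "i < k" for i
    using g that by auto
  \<comment> \<open>Conjugation by \<open>u\<close> outside \<open>K 0\<close> is harmless: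
    \<open>A\<close> is normal in the whole group, so a conjugated coordinate is still a
    homomorphism into \<open>A\<close>.\<close>
  have coord: "P 0 (\<lambda>h. u \<otimes> h i \<otimes> inv u)" if u: "u \<in> carrier G" and i: "i < k" for u i
  proof (rule poly_map_hom)
    show "(\<lambda>h. u \<otimes> h i \<otimes> inv u) \<in> hom Y G"
    proof (rule homI)
      fix h h' assume h: "h \<in> carrier Y" "h' \<in> carrier Y"
      have "(h \<otimes>\<^bsub>Y\<^esub> h') i = h i \<otimes> h' i" using i by (simp add: Y)
      then show "u \<otimes> (h \<otimes>\<^bsub>Y\<^esub> h') i \<otimes> inv u = u \<otimes> h i \<otimes> inv u \<otimes> (u \<otimes> h' i \<otimes> inv u)"
        using A.mem_carrier[OF hA[OF h(1) i]] A.mem_carrier[OF hA[OF h(2) i]] u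
        by (simp add: m_assoc)
    qed (use u hA i in auto)
    show "u \<otimes> h i \<otimes> inv u \<in> K (Suc 0)" if "h \<in> carrier Y" for h
      using A.inv_op_closed2[OF u hA[OF that i]] A(2) by blast
  qed
  \<comment> \<open>The error must be polynomial after conjugation by every \<open>u\<close>,
    because \<open>u\<close> will be the inverse of the value of the word that follows the
    letter.\<close>
  have letter: "\<exists>E. (\<forall>u\<in>carrier G. P 0 (\<lambda>h. u \<otimes> E h \<otimes> inv u)) \<and>
      (\<forall>h\<in>carrier Y. E h \<in> carrier G \<and>
        eval_letter G (\<lambda>i. g i \<otimes> h i) l = eval_letter G g l \<otimes> E h)"
    if l: "l \<in> letters k G" for l
  proof (cases l)
    case (Var i)
    then have i: "i < k" using l by (auto simp: letters_def)
    show ?thesis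
      using coord[OF _ i] A.mem_carrier[OF hA[OF _ i]]
      by (intro exI[of _ "\<lambda>h. h i"]) (simp add: Var)
  next
    case (VarInv i)
    then have i: "i < k" using l by (auto simp: letters_def)
    \<comment> \<open>For an inverse variable the error is found from (g h)^-1 = g^-1 (g h^-1
      g^-1).\<close>
    have "P 0 (\<lambda>h. u \<otimes> (g i \<otimes> inv (h i) \<otimes> inv (g i)) \<otimes> inv u)" if u: "u \<in> carrier G" for u
    proof (rule poly_map_cong_on[OF poly_map_inv[OF coord[OF _ i]]])
      show "u \<otimes> g i \<in> carrier G" using u gG[OF i] by simp
      show "inv (u \<otimes> g i \<otimes> h i \<otimes> inv (u \<otimes> g i)) = u \<otimes> (g i \<otimes> inv (h i) \<otimes> inv (g i)) \<otimes> inv u"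
        if "h \<in> carrier Y" for h
        using u gG[OF i] A.mem_carrier[OF hA[OF that i]] by (simp add: group_word_simps)
    qed
    moreover have "g i \<otimes> inv (h i) \<otimes> inv (g i) \<in> carrier G \<and>
        inv (g i \<otimes> h i) = inv (g i) \<otimes> (g i \<otimes> inv (h i) \<otimes> inv (g i))" if "h \<in> carrier Y" for h
      using gG[OF i] A.mem_carrier[OF hA[OF that i]] by (simp add: group_word_simps)
    ultimately show ?thesis
      by (intro exI[of _ "\<lambda>h. g i \<otimes> inv (h i) \<otimes> inv (g i)"]) (simp add: VarInv)
  next
    case (Const c)
    then have "c \<in> carrier G" using l by (auto simp: letters_def)
    then show ?thesis
      using poly_map_one by (intro exI[of _ "\<lambda>h. \<one>"]) (simp add: Const)
  qed
  show ?thesis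
    using w
  proof induction
    case Nil
    then show ?case using poly_map_one by (intro exI[of _ "\<lambda>h. \<one>"]) (simp add: eval_word_def)
  next
    case (Cons l w)
    obtain F where F: "P 0 F"
      "\<And>h. h \<in> carrier Y \<Longrightarrow> eval_word G (\<lambda>i. g i \<otimes> h i) w = eval_word G g w \<otimes> F h"
      using Cons.IH by blast
    obtain E where E: "\<And>u. u \<in> carrier G \<Longrightarrow> P 0 (\<lambda>h. u \<otimes> E h \<otimes> inv u)"
      "\<And>h. h \<in> carrier Y \<Longrightarrow> E h \<in> carrier G"
      "\<And>h. h \<in> carrier Y \<Longrightarrow>
        eval_letter G (\<lambda>i. g i \<otimes> h i) l = eval_letter G g l \<otimes> E h"
      using letter[OF Cons.hyps(1)] by blast
    let ?W = "eval_word G g w"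
    have W: "?W \<in> carrier G" by (rule eval_word_closed[OF is_group g Cons.hyps(2)])
    have L: "eval_letter G g l \<in> carrier G"
      by (rule eval_letter_closed[OF is_group g Cons.hyps(1)])
    show ?case
    proof (intro exI conjI ballI)
      show "P 0 (\<lambda>h. (inv ?W \<otimes> E h \<otimes> inv (inv ?W)) \<otimes> F h)"
        using W by (intro poly_map_mult[OF n] E(1) F(1)) simp
      show "eval_word G (\<lambda>i. g i \<otimes> h i) (l # w) =
          eval_word G g (l # w) \<otimes> ((inv ?W \<otimes> E h \<otimes> inv (inv ?W)) \<otimes> F h)"
        if h: "h \<in> carrier Y" for h
        using W L E(2)[OF h] poly_map_closed[OF F(1) h]
        by (simp add: eval_word_Cons E(3)[OF h] F(2)[OF h] m_assoc)
    qed
  qed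
qed

text \<open>Rigidity at \<open>s = 0\<close> for the word on a coset of the \<open>k\<close>-th
  power of \<open>A\<close>. The value at \<open>g\<close> is required to lie in \<open>K 0\<close>
  so that it is a constant polynomial map of level 0.\<close>

lemma (in group_filtration) eval_word_mostly_one:
  assumes A: "A \<lhd> G" "finite A" "A \<subseteq> K (Suc 0)" and n: "K n = {\<one>}"
    and g: "g \<in> {..<k} \<rightarrow> carrier G" and w: "w \<in> lists (letters k G)" "eval_word G g w \<in> K 0"
    and few: "card {h \<in> {..<k} \<rightarrow>\<^sub>E A. eval_word G (\<lambda>i. g i \<otimes> h i) w \<noteq> \<one>} * 2 ^ n < card A ^ k"
    and h: "h \<in> {..<k} \<rightarrow>\<^sub>E A"
  shows "eval_word G (\<lambda>i. g i \<otimes> h i) w = \<one>"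
proof -
  define Y where "Y = product_group {..<k} (\<lambda>_. G\<lparr>carrier := A\<rparr>)"
  have carrier: "carrier Y = {..<k} \<rightarrow>\<^sub>E A" by (simp add: Y_def)
  have "group Y"
    using subgroup_imp_group[OF normal_imp_subgroup[OF A(1)]] by (simp add: Y_def)
  then interpret poly_maps G K Y
    by (rule poly_maps.intro[OF group_filtration_axioms])
  obtain F where F: "P 0 F"
    "\<And>h. h \<in> carrier Y \<Longrightarrow> eval_word G (\<lambda>i. g i \<otimes> h i) w = eval_word G g w \<otimes> F h"
    using eval_word_poly_map[OF A(1,3) n Y_def g w(1)] by blast
  have "P 0 (\<lambda>h. eval_word G (\<lambda>i. g i \<otimes> h i) w)"
    by (rule poly_map_cong_on[OF poly_map_mult[OF n poly_map_const[OF w(2)] F(1)]]) (simp add: F(2))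
  then show ?thesis
    using A(2) n few h
    by (intro poly_map_mostly_one[where s = 0 and n = n and f = "\<lambda>h. eval_word G (\<lambda>i. g i \<otimes> h i) w"])
      (simp_all add: carrier finite_PiE card_PiE)
qed

section \<open>Solutions in finite quotients\<close>

definition coset_tuple :: "nat \<Rightarrow> ('a, 'b) monoid_scheme \<Rightarrow> 'a set \<Rightarrow> (nat \<Rightarrow> 'a) \<Rightarrow> nat \<Rightarrow> 'a set" where
  "coset_tuple k G N g = (\<lambda>i\<in>{..<k}. N #>\<^bsub>G\<^esub> g i)"

text \<open>Phrased through representatives, so that no word over the quotient occurs;
  \<open>quotient_solutions_eq\<close> identifies it with the solution set in the quotient.\<close>

definition quotient_solutions ::
    "nat \<Rightarrow> ('a, 'b) monoid_scheme \<Rightarrow> 'a letter list \<Rightarrow> 'a set \<Rightarrow> (nat \<Rightarrow> 'a set) set" where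
  "quotient_solutions k G w N =
     coset_tuple k G N ` {g \<in> {..<k} \<rightarrow>\<^sub>E carrier G. eval_word G g w \<in> N}"

text \<open>The condition is over \<open>G\<close>, not over the quotient: these blocks bound the
  solution set in \<open>G\<close> from below.\<close>

definition coset_solutions ::
    "nat \<Rightarrow> ('a, 'b) monoid_scheme \<Rightarrow> 'a letter list \<Rightarrow> 'a set \<Rightarrow> (nat \<Rightarrow> 'a set) set" where
  "coset_solutions k G w N =
     {q \<in> {..<k} \<rightarrow>\<^sub>E carrier (G Mod N). \<forall>g \<in> {..<k} \<rightarrow>\<^sub>E carrier G.
        (\<forall>i<k. g i \<in> q i) \<longrightarrow> eval_word G g w = \<one>\<^bsub>G\<^esub>}"

context group
begin

lemma group_hom_Mod:
  assumes "N \<lhd> G"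
  shows "group_hom G (G Mod N) ((#>) N)"
  using normal.factorgroup_is_group[OF assms] normal.r_coset_hom_Mod[OF assms]
  by (intro group_hom.intro group_hom_axioms.intro is_group)

lemma r_coset_eq_iff:
  assumes "N \<lhd> G" "x \<in> carrier G" "y \<in> carrier G"
  shows "N #> x = N #> y \<longleftrightarrow> x \<in> N #> y"
  using repr_independence[OF _ assms(3) normal_imp_subgroup[OF assms(1)]]
    rcos_self[OF assms(2) normal_imp_subgroup[OF assms(1)]] by metis

lemma coset_tuple_in:
  "g \<in> {..<k} \<rightarrow>\<^sub>E carrier G \<Longrightarrow> coset_tuple k G N g \<in> {..<k} \<rightarrow>\<^sub>E carrier (G Mod N)"
  by (auto simp: coset_tuple_def carrier_FactGroup)

lemma coset_tuple_surj:
  assumes "q \<in> {..<k} \<rightarrow>\<^sub>E carrier (G Mod N)"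
  obtains g where "g \<in> {..<k} \<rightarrow>\<^sub>E carrier G" "q = coset_tuple k G N g"
proof -
  have "\<forall>i\<in>{..<k}. \<exists>x. x \<in> carrier G \<and> q i = N #> x"
    using assms by (auto simp: carrier_FactGroup)
  then obtain g where g: "\<forall>i\<in>{..<k}. g i \<in> carrier G \<and> q i = N #> g i"
    by (auto dest!: bchoice)
  have "q = coset_tuple k G N (restrict g {..<k})"
    using g assms by (auto simp: coset_tuple_def fun_eq_iff PiE_def extensional_def)
  with g show ?thesis by (intro that[of "restrict g {..<k}"]) auto
qed

lemma coset_tuple_eq_iff:
  assumes N: "N \<lhd> G" and g: "g \<in> {..<k} \<rightarrow>\<^sub>E carrier G" and q: "q \<in> {..<k} \<rightarrow>\<^sub>E carrier (G Mod N)"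
  shows "coset_tuple k G N g = q \<longleftrightarrow> (\<forall>i<k. g i \<in> q i)"
proof -
  obtain g' where g': "g' \<in> {..<k} \<rightarrow>\<^sub>E carrier G" "q = coset_tuple k G N g'"
    using q by (rule coset_tuple_surj)
  have "coset_tuple k G N g = q \<longleftrightarrow> (\<forall>i<k. N #> g i = N #> g' i)"
    by (auto simp: g'(2) coset_tuple_def fun_eq_iff)
  also have "\<dots> \<longleftrightarrow> (\<forall>i<k. g i \<in> N #> g' i)"
    using g g'(1) r_coset_eq_iff[OF N] by (auto simp: PiE_iff)
  finally show ?thesis by (simp add: g'(2) coset_tuple_def)
qed

lemma eval_word_coset_tuple:
  assumes N: "N \<lhd> G" and g: "g \<in> {..<k} \<rightarrow>\<^sub>E carrier G" and w: "w \<in> lists (letters k G)"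
  shows "eval_word (G Mod N) (coset_tuple k G N g) (map (map_letter ((#>) N)) w) =
    N #> eval_word G g w"
proof -
  interpret group_hom G "G Mod N" "(#>) N" by (rule group_hom_Mod[OF N])
  have "map (map_letter ((#>) N)) w \<in> lists (letters k (G Mod N))"
    using w by (intro map_letter_in_letters) auto
  then have "eval_word (G Mod N) (coset_tuple k G N g) (map (map_letter ((#>) N)) w) =
      eval_word (G Mod N) (\<lambda>i. N #> g i) (map (map_letter ((#>) N)) w)"
    by (rule eval_word_cong_fun) (simp add: coset_tuple_def)
  then show ?thesis
    using eval_word_map[of g k w] g w by (auto simp: PiE_iff)
qed

lemma r_coset_eq_one_iff:
  assumes "N \<lhd> G" "x \<in> carrier G"
  shows "N #> x = N \<longleftrightarrow> x \<in> N"
  using assms normal_imp_subgroup coset_join1 coset_join2 by (metis subgroup.subset)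

text \<open>Modulo \<open>N\<close> the value of \<open>w\<close> depends only on the cosets of its
  arguments, so any representative may be tested.\<close>

lemma coset_tuple_in_quotient_solutions_iff:
  assumes N: "N \<lhd> G" and g: "g \<in> {..<k} \<rightarrow>\<^sub>E carrier G" and w: "w \<in> lists (letters k G)"
  shows "coset_tuple k G N g \<in> quotient_solutions k G w N \<longleftrightarrow> eval_word G g w \<in> N"
proof
  assume "coset_tuple k G N g \<in> quotient_solutions k G w N"
  then obtain g' where g': "g' \<in> {..<k} \<rightarrow>\<^sub>E carrier G" "eval_word G g' w \<in> N"
    and eq: "coset_tuple k G N g = coset_tuple k G N g'"
    by (auto simp: quotient_solutions_def)
  have "N #> eval_word G g w = N #> eval_word G g' w"
    using eval_word_coset_tuple[OF N g w] eval_word_coset_tuple[OF N g'(1) w] eq by simp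
  moreover have "eval_word G g w \<in> carrier G" "eval_word G g' w \<in> carrier G"
    using g g'(1) by (simp_all add: eval_word_closed[OF is_group _ w] PiE_def)
  ultimately show "eval_word G g w \<in> N"
    using g'(2) r_coset_eq_one_iff[OF N] by metis
qed (use g in \<open>auto simp: quotient_solutions_def\<close>)

lemma quotient_solutions_eq:
  assumes N: "N \<lhd> G" and w: "w \<in> lists (letters k G)"
  shows "quotient_solutions k G w N = {q \<in> {..<k} \<rightarrow>\<^sub>E carrier (G Mod N).
    eval_word (G Mod N) q (map (map_letter ((#>) N)) w) = \<one>\<^bsub>G Mod N\<^esub>}"
proof -
  have *: "q \<in> quotient_solutions k G w N \<longleftrightarrow>
      eval_word (G Mod N) q (map (map_letter ((#>) N)) w) = \<one>\<^bsub>G Mod N\<^esub>"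
    if q: "q \<in> {..<k} \<rightarrow>\<^sub>E carrier (G Mod N)" for q
  proof -
    obtain g where g: "g \<in> {..<k} \<rightarrow>\<^sub>E carrier G" "q = coset_tuple k G N g"
      using q by (rule coset_tuple_surj)
    have "g \<in> {..<k} \<rightarrow> carrier G" using g(1) by (simp add: PiE_def)
    then have "eval_word G g w \<in> carrier G"
      by (rule eval_word_closed[OF is_group _ w])
    then show ?thesis
      using coset_tuple_in_quotient_solutions_iff[OF N g(1) w] eval_word_coset_tuple[OF N g(1) w]
        r_coset_eq_one_iff[OF N] by (simp add: g(2))
  qed
  have "quotient_solutions k G w N \<subseteq> {..<k} \<rightarrow>\<^sub>E carrier (G Mod N)"
    unfolding quotient_solutions_def using coset_tuple_in by blast
  then have iff: "q \<in> quotient_solutions k G w N \<longleftrightarrow> q \<in> {..<k} \<rightarrow>\<^sub>E carrier (G Mod N) \<and>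
      eval_word (G Mod N) q (map (map_letter ((#>) N)) w) = \<one>\<^bsub>G Mod N\<^esub>" for q
    using *[of q] by (meson subsetD)
  show ?thesis by (rule Set.set_eqI) (simp only: mem_Collect_eq iff)
qed

lemma coset_solutions_subset:
  assumes N: "N \<lhd> G" and w: "w \<in> lists (letters k G)"
  shows "coset_solutions k G w N \<subseteq> quotient_solutions k G w N"
proof
  fix q assume q: "q \<in> coset_solutions k G w N"
  then have qE: "q \<in> {..<k} \<rightarrow>\<^sub>E carrier (G Mod N)" by (simp add: coset_solutions_def)
  then obtain g where g: "g \<in> {..<k} \<rightarrow>\<^sub>E carrier G" "q = coset_tuple k G N g"
    by (rule coset_tuple_surj)
  have "\<forall>i<k. g i \<in> q i"
    using coset_tuple_eq_iff[OF N g(1) qE] g(2) by simp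
  then have "eval_word G g w = \<one>"
    using q g(1) by (simp add: coset_solutions_def)
  then show "q \<in> quotient_solutions k G w N"
    using coset_tuple_in_quotient_solutions_iff[OF N g(1) w] g(2)
      subgroup.one_closed[OF normal_imp_subgroup[OF N]] by simp
qed

section \<open>Cosets of a smaller normal subgroup inside those of a larger one\<close>

lemma subcosets_eq:
  assumes H: "H \<lhd> G" and L: "L \<lhd> G" and "L \<subseteq> H" and g: "g \<in> carrier G"
  shows "{c \<in> carrier (G Mod L). c \<subseteq> H #> g} = (\<lambda>a. (L #> g) \<otimes>\<^bsub>G Mod L\<^esub> a) ` ((#>) L ` H)"
proof -
  interpret H: normal H G by fact
  interpret L: normal L G by fact
  have *: "L #> x \<subseteq> H #> g \<longleftrightarrow> (\<exists>a\<in>H. x = g \<otimes> a)" if x: "x \<in> carrier G" for x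
  proof
    assume "L #> x \<subseteq> H #> g"
    then have "x \<in> H #> g" using rcos_self[OF x L.subgroup_axioms] by blast
    then have "x \<in> g <# H" using H.coset_eq g by simp
    then show "\<exists>a\<in>H. x = g \<otimes> a" by (auto simp: l_coset_def)
  next
    assume "\<exists>a\<in>H. x = g \<otimes> a"
    then have "x \<in> g <# H" by (auto simp: l_coset_def)
    then have "x \<in> H #> g" using H.coset_eq g by simp
    then have "H #> x = H #> g" using r_coset_eq_iff[OF H x g] by simp
    moreover have "L #> x \<subseteq> H #> x" using \<open>L \<subseteq> H\<close> by (auto simp: r_coset_def)
    ultimately show "L #> x \<subseteq> H #> g" by simp
  qed
  have sub: "L #> (g \<otimes> a) \<subseteq> H #> g" if "a \<in> H" for a
    using *[of "g \<otimes> a"] that g by auto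
  have "{c \<in> carrier (G Mod L). c \<subseteq> H #> g} = (\<lambda>a. L #> (g \<otimes> a)) ` H"
    using g * by (auto simp: carrier_FactGroup dest: subsetD[OF sub])
  also have "(\<lambda>a. L #> (g \<otimes> a)) ` H = (\<lambda>a. (L #> g) \<otimes>\<^bsub>G Mod L\<^esub> a) ` ((#>) L ` H)"
    unfolding image_image
    by (rule image_cong)
      (use g in \<open>simp_all only: group_hom.hom_mult[OF group_hom_Mod[OF L]] H.mem_carrier\<close>)
  finally show ?thesis .
qed

lemma card_subcosets:
  assumes H: "H \<lhd> G" and L: "L \<lhd> G" and "L \<subseteq> H" and g: "g \<in> carrier G"
  shows "card {c \<in> carrier (G Mod L). c \<subseteq> H #> g} = card ((#>) L ` H)"
  unfolding subcosets_eq[OF assms]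
proof (rule card_image, rule inj_onI)
  interpret H: normal H G by fact
  interpret group_hom G "G Mod L" "(#>) L" by (rule group_hom_Mod[OF L])
  fix a b assume "a \<in> (#>) L ` H" "b \<in> (#>) L ` H"
  then have "a \<in> carrier (G Mod L)" "b \<in> carrier (G Mod L)"
    using H.mem_carrier hom_closed by blast+
  then show "a = b" if "(L #> g) \<otimes>\<^bsub>G Mod L\<^esub> a = (L #> g) \<otimes>\<^bsub>G Mod L\<^esub> b"
    using that g hom_closed H.l_cancel by blast
qed

lemma coset_tuple_subset_iff:
  assumes H: "H \<lhd> G" and L: "L \<lhd> G" and "L \<subseteq> H"
    and g: "g \<in> {..<k} \<rightarrow>\<^sub>E carrier G" and q: "q \<in> {..<k} \<rightarrow>\<^sub>E carrier (G Mod H)"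
  shows "(\<forall>i<k. coset_tuple k G L g i \<subseteq> q i) \<longleftrightarrow> q = coset_tuple k G H g"
proof -
  have qG: "q i \<in> carrier (G Mod H)" if "i < k" for i
    using q that by auto
  have gG: "g i \<in> carrier G" if "i < k" for i
    using g that by auto
  have "L #> g i \<subseteq> q i \<longleftrightarrow> g i \<in> q i" if i: "i < k" for i
  proof
    assume "L #> g i \<subseteq> q i"
    then show "g i \<in> q i" using rcos_self[OF gG[OF i] normal_imp_subgroup[OF L]] by blast
  next
    assume gq: "g i \<in> q i"
    obtain x where x: "x \<in> carrier G" "q i = H #> x"
      using qG[OF i] by (auto simp: carrier_FactGroup)
    have "q i = H #> g i"
      using gq r_coset_eq_iff[OF H gG[OF i] x(1)] by (simp add: x(2))
    then show "L #> g i \<subseteq> q i" using \<open>L \<subseteq> H\<close> by (auto simp: r_coset_def)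
  qed
  then show ?thesis
    using coset_tuple_eq_iff[OF H g q] by (auto simp: coset_tuple_def)
qed

lemma card_subcoset_tuples:
  assumes H: "H \<lhd> G" and L: "L \<lhd> G" and "L \<subseteq> H" and q: "q \<in> {..<k} \<rightarrow>\<^sub>E carrier (G Mod H)"
  shows "card {x \<in> {..<k} \<rightarrow>\<^sub>E carrier (G Mod L). \<forall>i<k. x i \<subseteq> q i} = card ((#>) L ` H) ^ k"
proof -
  have "{x \<in> {..<k} \<rightarrow>\<^sub>E carrier (G Mod L). \<forall>i<k. x i \<subseteq> q i} =
      (\<Pi>\<^sub>E i\<in>{..<k}. {c \<in> carrier (G Mod L). c \<subseteq> q i})"
    by (intro Set.set_eqI) (simp only: PiE_iff mem_Collect_eq Ball_def lessThan_iff, blast)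
  also have "card \<dots> = (\<Prod>i<k. card {c \<in> carrier (G Mod L). c \<subseteq> q i})"
    by (simp add: card_PiE)
  also have "\<dots> = (\<Prod>i<k. card ((#>) L ` H))"
  proof (rule prod.cong)
    fix i assume "i \<in> {..<k}"
    then have "q i \<in> carrier (G Mod H)" using q by auto
    then obtain x where x: "x \<in> carrier G" "q i = H #> x"
      by (auto simp: carrier_FactGroup)
    show "card {c \<in> carrier (G Mod L). c \<subseteq> q i} = card ((#>) L ` H)"
      using card_subcosets[OF H L \<open>L \<subseteq> H\<close> x(1)] by (simp add: x(2))
  qed simp
  finally show ?thesis by simp
qed

lemma subcoset_tuples_partition:
  fixes k :: nat
  assumes H: "H \<lhd> G" and L: "L \<lhd> G" and "L \<subseteq> H"
    and x: "x \<in> {..<k} \<rightarrow>\<^sub>E carrier (G Mod L)"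
  shows "\<exists>!q. q \<in> {..<k} \<rightarrow>\<^sub>E carrier (G Mod H) \<and> (\<forall>i<k. x i \<subseteq> q i)"
proof -
  obtain g where g: "g \<in> {..<k} \<rightarrow>\<^sub>E carrier G" "x = coset_tuple k G L g"
    using x by (rule coset_tuple_surj)
  note iff = coset_tuple_subset_iff[OF assms(1-3) g(1)]
  show ?thesis
    unfolding g(2)
  proof (rule ex1I)
    show "coset_tuple k G H g \<in> {..<k} \<rightarrow>\<^sub>E carrier (G Mod H) \<and>
        (\<forall>i<k. coset_tuple k G L g i \<subseteq> coset_tuple k G H g i)"
      using iff[OF coset_tuple_in[OF g(1)]] coset_tuple_in[OF g(1)] by simp
    show "q = coset_tuple k G H g"
      if "q \<in> {..<k} \<rightarrow>\<^sub>E carrier (G Mod H) \<and> (\<forall>i<k. coset_tuple k G L g i \<subseteq> q i)" for q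
      using iff[of q] that by simp
  qed
qed

text \<open>Multiplicativity of the index, raised to the power \<open>k\<close>; the last factor is
  a power of the index of \<open>L\<close> in \<open>H\<close>.\<close>

lemma card_coset_tuples:
  assumes H: "H \<lhd> G" and L: "L \<lhd> G" and "L \<subseteq> H"
    and fin: "finite (carrier (G Mod H))" "finite (carrier (G Mod L))"
  shows "card (carrier (G Mod L)) ^ k = card (carrier (G Mod H)) ^ k * card ((#>) L ` H) ^ k"
proof -
  define Q where "Q = {..<k} \<rightarrow>\<^sub>E carrier (G Mod H)"
  define T where "T = {..<k} \<rightarrow>\<^sub>E carrier (G Mod L)"
  define B where "B q = {x \<in> T. \<forall>i<k. x i \<subseteq> q i}" for q :: "nat \<Rightarrow> 'a set"
  have part: "\<exists>!q. q \<in> Q \<and> x \<in> B q" if "x \<in> T" for x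
    using subcoset_tuples_partition[OF assms(1-3), of x k] that by (simp add: T_def Q_def B_def)
  have finT: "finite T" and finQ: "finite Q" using fin by (auto simp: T_def Q_def intro: finite_PiE)
  have BT: "B q \<subseteq> T" for q by (auto simp: B_def)
  have "T = (\<Union>q\<in>Q. B q)" using part BT by blast
  then have "card T = card (\<Union>q\<in>Q. B q)" by simp
  also have "\<dots> = (\<Sum>q\<in>Q. card (B q))"
  proof (rule card_UN_disjoint[OF finQ])
    show "\<forall>q\<in>Q. \<forall>q'\<in>Q. q \<noteq> q' \<longrightarrow> B q \<inter> B q' = {}" using part BT by blast
    show "\<forall>q\<in>Q. finite (B q)" using finite_subset[OF BT finT] by blast
  qed
  also have "\<dots> = (\<Sum>q\<in>Q. card ((#>) L ` H) ^ k)"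
    using card_subcoset_tuples[OF assms(1-3), of _ k]
    by (intro sum.cong) (simp_all add: B_def T_def Q_def)
  finally show ?thesis by (simp add: T_def Q_def card_PiE)
qed

text \<open>
  A coset of \<open>H\<close> in which most, but not all, points solve the equation modulo \<open>L\<close> would
  contradict the rigidity of polynomial maps.
\<close>

lemma card_nonsolutions_ge:
  assumes H: "H \<lhd> G" and L: "L \<lhd> G" and "L \<subseteq> H" and fin: "finite (carrier (G Mod L))"
    and w: "w \<in> lists (letters k G)"
    and K: "group_filtration (G Mod L) K" "(#>) L ` H \<subseteq> K (Suc 0)" "K n = {\<one>\<^bsub>G Mod L\<^esub>}"
    and g: "g \<in> {..<k} \<rightarrow>\<^sub>E carrier G" "eval_word G g w \<in> H" "eval_word G g w \<notin> L"
  shows "card ((#>) L ` H) ^ k \<le>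
    card {x \<in> {..<k} \<rightarrow>\<^sub>E carrier (G Mod L).
      (\<forall>i<k. x i \<subseteq> coset_tuple k G H g i) \<and> x \<notin> quotient_solutions k G w L} * 2 ^ n"
proof (rule ccontr)
  let ?A = "(#>) L ` H" and ?w = "map (map_letter ((#>) L)) w"
  let ?B = "{x \<in> {..<k} \<rightarrow>\<^sub>E carrier (G Mod L).
      (\<forall>i<k. x i \<subseteq> coset_tuple k G H g i) \<and> x \<notin> quotient_solutions k G w L}"
  assume "\<not> ?thesis"
  then have few: "card ?B * 2 ^ n < card ?A ^ k" by simp
  have "finite ({..<k} \<rightarrow>\<^sub>E carrier (G Mod L))" using fin by (simp add: finite_PiE)
  then have finB: "finite ?B" by (rule rev_finite_subset) blast
  interpret Q: group_filtration "G Mod L" K by fact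
  interpret hom: group_hom G "G Mod L" "(#>) L" by (rule group_hom_Mod[OF L])
  let ?x = "coset_tuple k G L g"
  have x: "?x \<in> {..<k} \<rightarrow>\<^sub>E carrier (G Mod L)" by (rule coset_tuple_in[OF g(1)])
  have gG: "g i \<in> carrier G" if "i < k" for i
    using g that by auto
  have A: "?A \<lhd> G Mod L"
    using normal.surj_hom_normal_subgroup[OF H hom.group_hom_axioms] by (simp add: carrier_FactGroup)
  have AQ: "a \<in> carrier (G Mod L)" if "a \<in> ?A" for a
    using subgroup.mem_carrier[OF normal_imp_subgroup[OF A] that] .
  have wQ: "?w \<in> lists (letters k (G Mod L))"
    using w by (intro map_letter_in_letters) auto
  have "eval_word (G Mod L) ?x ?w = L #> eval_word G g w"
    by (rule eval_word_coset_tuple[OF L g(1) w])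
  \<comment> \<open>The value at \<open>g\<close> lies in \<open>H\<close>, so modulo
    \<open>L\<close> it lies in \<open>?A\<close> and hence in \<open>K 0\<close>, as rigidity
    requires.\<close>
  then have ev: "eval_word (G Mod L) ?x ?w \<in> K 0"
    using g(2) K(2) Q.K_Suc_subset[of 0] by auto
  \<comment> \<open>\<open>sh\<close> translates tuples over \<open>?A\<close> injectively into the
    subcosets, which transfers the bound on nonsolutions. \<open>e\<close> is the origin: its
    translate is \<open>?x\<close>, which rigidity would force to be a solution modulo
    \<open>L\<close>.\<close>
  define e where "e = (\<lambda>i\<in>{..<k}. \<one>\<^bsub>G Mod L\<^esub>)"
  define sh where "sh = (\<lambda>h. \<lambda>i\<in>{..<k}. ?x i \<otimes>\<^bsub>G Mod L\<^esub> h i)"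
  have sh_eval: "eval_word (G Mod L) (\<lambda>i. ?x i \<otimes>\<^bsub>G Mod L\<^esub> h i) ?w = eval_word (G Mod L) (sh h) ?w" for h
    by (rule eval_word_cong_fun[OF wQ]) (simp add: sh_def)
  have sh_in: "sh h \<in> {..<k} \<rightarrow>\<^sub>E carrier (G Mod L)" "\<forall>i<k. sh h i \<subseteq> coset_tuple k G H g i"
    if h: "h \<in> {..<k} \<rightarrow>\<^sub>E ?A" for h
  proof -
    have "sh h i \<in> carrier (G Mod L) \<and> sh h i \<subseteq> H #> g i" if i: "i < k" for i
    proof -
      have "?x i \<otimes>\<^bsub>G Mod L\<^esub> h i \<in> {c \<in> carrier (G Mod L). c \<subseteq> H #> g i}"
        unfolding subcosets_eq[OF H L \<open>L \<subseteq> H\<close> gG[OF i]]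
        using h i by (auto simp only: coset_tuple_def lessThan_iff restrict_apply if_True PiE_iff intro!: imageI)
      then show ?thesis using i by (simp only: sh_def lessThan_iff restrict_apply if_True mem_Collect_eq)
    qed
    note * = this
    show "sh h \<in> {..<k} \<rightarrow>\<^sub>E carrier (G Mod L)"
    proof (rule PiE_I)
      show "sh h i \<in> carrier (G Mod L)" if "i \<in> {..<k}" for i
        using *[of i] that by simp
    qed (simp add: sh_def)
    show "\<forall>i<k. sh h i \<subseteq> coset_tuple k G H g i"
      using * by (simp add: coset_tuple_def)
  qed
  have sh_inj: "inj_on sh ({..<k} \<rightarrow>\<^sub>E ?A)"
  proof (rule inj_onI)
    fix h h' assume h: "h \<in> {..<k} \<rightarrow>\<^sub>E ?A" "h' \<in> {..<k} \<rightarrow>\<^sub>E ?A" and eq: "sh h = sh h'"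
    show "h = h'"
    proof (rule PiE_ext[OF h])
      fix i assume i: "i \<in> {..<k}"
      then have "?x i \<otimes>\<^bsub>G Mod L\<^esub> h i = ?x i \<otimes>\<^bsub>G Mod L\<^esub> h' i"
        using fun_cong[OF eq, of i] by (simp only: sh_def restrict_apply if_True)
      moreover have "?x i \<in> carrier (G Mod L)" using PiE_mem[OF x i] .
      ultimately show "h i = h' i"
        using Q.l_cancel AQ[OF PiE_mem[OF h(1) i]] AQ[OF PiE_mem[OF h(2) i]] by blast
    qed
  qed
  have sols: "quotient_solutions k G w L = {q \<in> {..<k} \<rightarrow>\<^sub>E carrier (G Mod L).
      eval_word (G Mod L) q ?w = \<one>\<^bsub>G Mod L\<^esub>}"
    by (rule quotient_solutions_eq[OF L w])
  let ?C = "{h \<in> {..<k} \<rightarrow>\<^sub>E ?A. eval_word (G Mod L) (\<lambda>i. ?x i \<otimes>\<^bsub>G Mod L\<^esub> h i) ?w \<noteq> \<one>\<^bsub>G Mod L\<^esub>}"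
  have "sh ` ?C \<subseteq> ?B"
    using sh_in unfolding sh_eval sols by blast
  then have "card (sh ` ?C) \<le> card ?B" by (rule card_mono[OF finB])
  moreover have "card (sh ` ?C) = card ?C"
    by (rule card_image) (rule inj_on_subset[OF sh_inj], blast)
  ultimately have "card ?C \<le> card ?B" by argo
  then have "card ?C * 2 ^ n < card ?A ^ k"
    by (rule le_less_trans[OF mult_le_mono1 few])
  moreover have "finite ?A"
    using finite_subset[OF _ fin] AQ by blast
  moreover have one: "e \<in> {..<k} \<rightarrow>\<^sub>E ?A"
    using subgroup.one_closed[OF normal_imp_subgroup[OF A]] unfolding e_def by auto
  moreover have "?x \<in> {..<k} \<rightarrow> carrier (G Mod L)" using x by (simp add: PiE_def)
  ultimately have "eval_word (G Mod L) (\<lambda>i. ?x i \<otimes>\<^bsub>G Mod L\<^esub> e i) ?w = \<one>\<^bsub>G Mod L\<^esub>"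
    using Q.eval_word_mostly_one[OF A _ K(2,3) _ wQ ev] by blast
  moreover have "sh e = ?x"
  proof (rule PiE_ext[OF sh_in(1)[OF one] x])
    fix i assume i: "i \<in> {..<k}"
    show "sh e i = ?x i"
      using i Q.r_one[OF PiE_mem[OF x i]] by (simp only: sh_def e_def restrict_apply if_True)
  qed
  ultimately have "?x \<in> quotient_solutions k G w L"
    unfolding sh_eval sols using x by simp
  then show False
    using coset_tuple_in_quotient_solutions_iff[OF L g(1) w] g(3) by simp
qed

text \<open>Solutions modulo \<open>L\<close> lie over solutions modulo \<open>H\<close>, and by
  \<open>sep\<close> each block that does not consist of solutions contains a point exposed modulo
  \<open>L\<close>, hence loses at least the proportion \<open>1 / 2 ^ n\<close> of its subcosets.
  Multiplying by \<open>2 ^ n\<close> keeps the count in the naturals.\<close>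

lemma card_quotient_solutions_le:
  assumes H: "H \<lhd> G" and L: "L \<lhd> G" and "L \<subseteq> H"
    and fin: "finite (carrier (G Mod H))" "finite (carrier (G Mod L))"
    and w: "w \<in> lists (letters k G)"
    and K: "group_filtration (G Mod L) K" "(#>) L ` H \<subseteq> K (Suc 0)" "K n = {\<one>\<^bsub>G Mod L\<^esub>}"
    and sep: "\<And>q. q \<in> quotient_solutions k G w H \<Longrightarrow> q \<notin> coset_solutions k G w H \<Longrightarrow>
      \<exists>g \<in> {..<k} \<rightarrow>\<^sub>E carrier G. coset_tuple k G H g = q \<and> eval_word G g w \<notin> L"
  shows "card (quotient_solutions k G w L) * 2 ^ n +
      card (quotient_solutions k G w H - coset_solutions k G w H) * card ((#>) L ` H) ^ k \<le>
    card (quotient_solutions k G w H) * card ((#>) L ` H) ^ k * 2 ^ n"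
proof -
  define S where "S = quotient_solutions k G w H"
  define D where "D = S - coset_solutions k G w H"
  define T where "T = quotient_solutions k G w L"
  define U where "U = {..<k} \<rightarrow>\<^sub>E carrier (G Mod L)"
  define B where "B q = {x \<in> U. \<forall>i<k. x i \<subseteq> q i}" for q :: "nat \<Rightarrow> 'a set"
  let ?a = "card ((#>) L ` H) ^ k"
  have SQ: "S \<subseteq> {..<k} \<rightarrow>\<^sub>E carrier (G Mod H)"
    unfolding S_def quotient_solutions_def using coset_tuple_in by blast
  have finU: "finite U" using fin by (simp add: U_def finite_PiE)
  have finS: "finite S" using fin by (intro finite_subset[OF SQ]) (simp add: finite_PiE)
  have finD: "finite D" and DS: "D \<subseteq> S" using finS by (auto simp: D_def)
  have finB: "finite (B q)" for q using finU by (simp add: B_def)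
  have disj: "q = q'" if "q \<in> S" "q' \<in> S" "x \<in> B q" "x \<in> B q'" for q q' x
    using subcoset_tuples_partition[OF assms(1-3), of x k] subsetD[OF SQ that(1)] subsetD[OF SQ that(2)]
      that(3,4) unfolding B_def U_def by auto
  have cardB: "card (B q) = ?a" if "q \<in> S" for q
    using card_subcoset_tuples[OF assms(1-3) subsetD[OF SQ that]] by (simp add: B_def U_def)
  have TB: "\<exists>q\<in>S. x \<in> B q" if x: "x \<in> T" for x
  proof -
    obtain g where g: "g \<in> {..<k} \<rightarrow>\<^sub>E carrier G" "eval_word G g w \<in> L" "x = coset_tuple k G L g"
      using x by (auto simp: T_def quotient_solutions_def)
    have "coset_tuple k G H g \<in> S"
      using coset_tuple_in_quotient_solutions_iff[OF H g(1) w] g(2) \<open>L \<subseteq> H\<close> by (auto simp: S_def)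
    moreover have "x \<in> B (coset_tuple k G H g)"
      using coset_tuple_subset_iff[OF assms(1-3) g(1) coset_tuple_in[OF g(1)]] coset_tuple_in[OF g(1)]
      by (simp add: B_def U_def g(3))
    ultimately show ?thesis by blast
  qed
  have nonsol: "?a \<le> card (B q - T) * 2 ^ n" if q: "q \<in> D" for q
  proof -
    obtain g where g: "g \<in> {..<k} \<rightarrow>\<^sub>E carrier G" "q = coset_tuple k G H g" "eval_word G g w \<notin> L"
      using sep[of q] q by (auto simp: D_def S_def)
    have "eval_word G g w \<in> H"
      using coset_tuple_in_quotient_solutions_iff[OF H g(1) w] g(2) q by (auto simp: D_def S_def)
    moreover have "B q - T = {x \<in> {..<k} \<rightarrow>\<^sub>E carrier (G Mod L).
        (\<forall>i<k. x i \<subseteq> coset_tuple k G H g i) \<and> x \<notin> quotient_solutions k G w L}"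
      by (auto simp only: B_def U_def T_def g(2))
    ultimately show ?thesis
      using card_nonsolutions_ge[OF assms(1-3) fin(2) w K g(1) _ g(3)] by simp
  qed
  \<comment> \<open>\<open>T\<close> and the nonsolutions over \<open>D\<close> are disjoint, and
    both lie in the disjoint union of the blocks \<open>B q\<close> over \<open>S\<close>.\<close>
  have "card T + (\<Sum>q\<in>D. card (B q - T)) = card T + card (\<Union>q\<in>D. B q - T)"
    using finD finB disj DS by (subst card_UN_disjoint) blast+
  also have "\<dots> = card (T \<union> (\<Union>q\<in>D. B q - T))"
  proof (rule card_Un_disjoint[symmetric])
    show "finite T"
      using TB by (intro finite_subset[of T "\<Union>q\<in>S. B q"] finite_UN_I[OF finS finB]) blast
  qed (use finD finB in auto)
  also have "\<dots> \<le> card (\<Union>q\<in>S. B q)"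
    using TB DS by (intro card_mono finite_UN_I[OF finS finB]) blast
  also have "\<dots> = (\<Sum>q\<in>S. card (B q))"
    using finS finB disj by (subst card_UN_disjoint) blast+
  also have "\<dots> = card S * ?a" using cardB by simp
  finally have "(card T + (\<Sum>q\<in>D. card (B q - T))) * 2 ^ n \<le> card S * ?a * 2 ^ n"
    by simp
  moreover have "card D * ?a \<le> (\<Sum>q\<in>D. card (B q - T)) * 2 ^ n"
    using sum_mono[of D "\<lambda>_. ?a" "\<lambda>q. card (B q - T) * 2 ^ n"] nonsol
    by (simp add: sum_distrib_right)
  ultimately show ?thesis
    by (simp add: S_def D_def T_def add_mult_distrib)
qed

end

section \<open>Product measures on tuples\<close>

definition power_measure :: "nat \<Rightarrow> 'a measure \<Rightarrow> (nat \<Rightarrow> 'a) measure" where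
  "power_measure k \<mu> = PiM {..<k} (\<lambda>_. \<mu>)"

lemma prob_space_power_measure: "prob_space \<mu> \<Longrightarrow> prob_space (power_measure k \<mu>)"
  unfolding power_measure_def by (intro prob_space_PiM)

lemma sets_power_measure_box:
  assumes "\<And>i. i < k \<Longrightarrow> B i \<in> sets \<mu>"
  shows "(\<Pi>\<^sub>E i\<in>{..<k}. B i) \<in> sets (power_measure k \<mu>)"
  unfolding power_measure_def using assms by (intro sets_PiM_I_finite) auto

lemma measure_power_measure_box:
  assumes "prob_space \<mu>" "\<And>i. i < k \<Longrightarrow> B i \<in> sets \<mu>"
  shows "measure (power_measure k \<mu>) (\<Pi>\<^sub>E i\<in>{..<k}. B i) = (\<Prod>i<k. measure \<mu> (B i))"
proof -
  interpret prob_space \<mu> by fact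
  interpret finite_product_prob_space "\<lambda>_. \<mu>" "{..<k}"
    by unfold_locales auto
  show ?thesis
    unfolding power_measure_def using assms(2) by (intro prob_times) auto
qed

text \<open>Each singleton is a box, and a countable set of tuples is a countable union of
  singletons. This makes the solution set of an equation measurable.\<close>

lemma sets_power_measure_countable:
  assumes "countable (space \<mu>)" "sets \<mu> = Pow (space \<mu>)" "Z \<subseteq> {..<k} \<rightarrow>\<^sub>E space \<mu>"
  shows "Z \<in> sets (power_measure k \<mu>)"
proof (rule sets.countable)
  show "countable Z"
    using countable_PiE[of "{..<k}" "\<lambda>_. space \<mu>"] assms(1,3) countable_subset by blast
  show "{z} \<in> sets (power_measure k \<mu>)" if "z \<in> Z" for z
  proof -
    have z: "z \<in> {..<k} \<rightarrow>\<^sub>E space \<mu>" using that assms(3) by blast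
    have "{z} = (\<Pi>\<^sub>E i\<in>{..<k}. {z i})"
      using z by (intro PiE_singleton[symmetric]) (simp add: PiE_iff)
    then show ?thesis
      using z sets_power_measure_box[of k "\<lambda>i. {z i}" \<mu>] assms(2) by (auto simp: PiE_iff)
  qed
qed

lemma measure_power_uniform_count_measure:
  assumes "finite S" "S \<noteq> {}" "Z \<subseteq> {..<k} \<rightarrow>\<^sub>E S"
  shows "measure (power_measure k (uniform_count_measure S)) Z = card Z / card S ^ k"
proof -
  let ?\<mu> = "uniform_count_measure S"
  have ps: "prob_space ?\<mu>" using assms by (intro prob_space_uniform_count_measure)
  interpret P: prob_space "power_measure k ?\<mu>" by (rule prob_space_power_measure[OF ps])
  have single: "measure (power_measure k ?\<mu>) {z} = 1 / card S ^ k" if "z \<in> Z" for z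
  proof -
    have z: "z \<in> {..<k} \<rightarrow>\<^sub>E S" using that assms(3) by blast
    have "{z} = (\<Pi>\<^sub>E i\<in>{..<k}. {z i})"
      using z by (intro PiE_singleton[symmetric]) (simp add: PiE_iff)
    also have "measure (power_measure k ?\<mu>) \<dots> = (\<Prod>i<k. measure ?\<mu> {z i})"
      using z by (intro measure_power_measure_box[OF ps]) (auto simp: sets_uniform_count_measure)
    also have "\<dots> = (\<Prod>i<k. 1 / card S)"
      using z assms(1) by (intro prod.cong) (auto simp: measure_uniform_count_measure PiE_iff)
    finally show ?thesis by (simp add: power_divide)
  qed
  have "countable S" using assms(1) by (rule countable_finite)
  then have "{z} \<in> sets (power_measure k ?\<mu>)" if "z \<in> Z" for z
    using that assms(3)
    by (intro sets_power_measure_countable)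
      (auto simp: space_uniform_count_measure sets_uniform_count_measure)
  moreover have "finite Z"
    using assms by (intro finite_subset[OF assms(3)] finite_PiE) auto
  ultimately have "measure (power_measure k ?\<mu>) Z = (\<Sum>z\<in>Z. measure (power_measure k ?\<mu>) {z})"
    by (intro P.finite_measure_eq_sum_singleton)
  also have "\<dots> = card Z / card S ^ k" by (simp add: single)
  finally show ?thesis .
qed

text \<open>The generated elements are products of finite lists over \<open>S\<close> and its
  inverses.\<close>

lemma (in group) countable_generate:
  assumes "countable S" "S \<subseteq> carrier G"
  shows "countable (generate G S)"
proof -
  let ?f = "\<lambda>xs. foldr (\<otimes>) xs \<one>" and ?T = "S \<union> m_inv G ` S"
  have TG: "?T \<subseteq> carrier G" using assms(2) by auto
  have closed: "?f xs \<in> carrier G" if "xs \<in> lists ?T" for xs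
    using that by induction (use TG in auto)
  have app: "?f (xs @ ys) = ?f xs \<otimes> ?f ys" if "xs \<in> lists ?T" "ys \<in> lists ?T" for xs ys
    using that(1)
  proof induction
    case Nil
    then show ?case using closed[OF that(2)] by simp
  next
    case (Cons x xs)
    have "x \<in> carrier G" using Cons.hyps TG by blast
    then show ?case using Cons closed[OF that(2)] closed[OF Cons.hyps(2)] by (simp add: m_assoc)
  qed
  have "x \<in> ?f ` lists ?T" if "x \<in> generate G S" for x
    using that
  proof induction
    case one
    show ?case by (rule image_eqI[of _ _ "[]"]) simp_all
  next
    case (incl h)
    then show ?case using assms(2) by (intro image_eqI[of _ _ "[h]"]) auto
  next
    case (inv h)
    then show ?case using assms(2) by (intro image_eqI[of _ _ "[inv h]"]) auto
  next
    case (eng h1 h2)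
    then obtain xs ys where "xs \<in> lists ?T" "ys \<in> lists ?T" "h1 = ?f xs" "h2 = ?f ys" by blast
    then show ?case using app[of xs ys] by (intro image_eqI[of _ _ "xs @ ys"]) auto
  qed
  moreover have "countable (?f ` lists ?T)"
    using assms(1) by (intro countable_image countable_lists) auto
  ultimately show ?thesis by (meson countable_subset subsetI)
qed

section \<open>Densities of periodic sets\<close>

definition coset_tuple_preimage ::
    "nat \<Rightarrow> ('a, 'b) monoid_scheme \<Rightarrow> 'a set \<Rightarrow> (nat \<Rightarrow> 'a set) set \<Rightarrow> (nat \<Rightarrow> 'a) set" where
  "coset_tuple_preimage k G N T = {g \<in> {..<k} \<rightarrow>\<^sub>E carrier G. coset_tuple k G N g \<in> T}"

context group
begin

text \<open>The preimage is a finite disjoint union of boxes whose sides are cosets.\<close>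

lemma measure_coset_tuple_preimage:
  assumes N: "N \<lhd> G" and \<mu>: "prob_measure_on G \<mu>"
    and T: "finite T" "T \<subseteq> {..<k} \<rightarrow>\<^sub>E carrier (G Mod N)"
  shows "coset_tuple_preimage k G N T \<in> sets (power_measure k \<mu>)"
    and "measure (power_measure k \<mu>) (coset_tuple_preimage k G N T) =
      (\<Sum>q\<in>T. \<Prod>i<k. measure \<mu> (q i))"
proof -
  have ps: "prob_space \<mu>" and sets: "sets \<mu> = Pow (carrier G)"
    using \<mu> by (auto simp: prob_measure_on_def)
  interpret P: prob_space "power_measure k \<mu>" by (rule prob_space_power_measure[OF ps])
  let ?B = "\<lambda>q. \<Pi>\<^sub>E i\<in>{..<k}. q i"
  have qsets: "q i \<in> sets \<mu>" if "q \<in> T" "i < k" for q i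
  proof -
    have "q i \<in> carrier (G Mod N)" using T(2) that by auto
    then show ?thesis
      using r_coset_subset_G[OF subgroup.subset[OF normal_imp_subgroup[OF N]]]
      by (auto simp: carrier_FactGroup sets)
  qed
  have B: "?B q \<in> sets (power_measure k \<mu>)" if "q \<in> T" for q
    using qsets[OF that] by (rule sets_power_measure_box)
  have mem: "g \<in> ?B q \<longleftrightarrow> g \<in> {..<k} \<rightarrow>\<^sub>E carrier G \<and> coset_tuple k G N g = q" if q: "q \<in> T" for g q
  proof
    assume g: "g \<in> ?B q"
    then have "g \<in> {..<k} \<rightarrow>\<^sub>E carrier G"
      using qsets[OF q] by (auto simp: PiE_iff sets)
    moreover from this have "coset_tuple k G N g = q"
      using coset_tuple_eq_iff[OF N _ subsetD[OF T(2) q]] g by (auto simp: PiE_iff)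
    ultimately show "g \<in> {..<k} \<rightarrow>\<^sub>E carrier G \<and> coset_tuple k G N g = q" by blast
  next
    assume "g \<in> {..<k} \<rightarrow>\<^sub>E carrier G \<and> coset_tuple k G N g = q"
    then show "g \<in> ?B q"
      using coset_tuple_eq_iff[OF N _ subsetD[OF T(2) q], of g] by (auto simp: PiE_iff)
  qed
  have eq: "coset_tuple_preimage k G N T = (\<Union>q\<in>T. ?B q)"
    unfolding coset_tuple_preimage_def using mem by (intro Set.set_eqI) auto
  show "coset_tuple_preimage k G N T \<in> sets (power_measure k \<mu>)"
    unfolding eq using T(1) B by (intro sets.finite_UN)
  have "measure (power_measure k \<mu>) (\<Union>q\<in>T. ?B q) = (\<Sum>q\<in>T. measure (power_measure k \<mu>) (?B q))"
  proof (rule P.finite_measure_finite_Union[OF T(1)])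
    show "?B ` T \<subseteq> sets (power_measure k \<mu>)" using B by blast
    show "disjoint_family_on ?B T"
      unfolding disjoint_family_on_def using mem by (metis (no_types, lifting) Int_emptyI)
  qed
  also have "\<dots> = (\<Sum>q\<in>T. \<Prod>i<k. measure \<mu> (q i))"
    using qsets by (intro sum.cong measure_power_measure_box[OF ps]) auto
  finally show "measure (power_measure k \<mu>) (coset_tuple_preimage k G N T) =
      (\<Sum>q\<in>T. \<Prod>i<k. measure \<mu> (q i))"
    by (simp only: eq)
qed

lemma tendsto_measure_coset:
  assumes N: "N \<lhd> G" "finite (carrier (G Mod N))" and M: "measures_index_uniformly G M"
    and c: "c \<in> carrier (G Mod N)"
  shows "(\<lambda>n. measure (M n) c) \<longlonglongrightarrow> 1 / card (carrier (G Mod N))"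
proof -
  obtain x where x: "x \<in> carrier G" "c = N #> x"
    using c by (auto simp: carrier_FactGroup)
  have "(x, N) \<in> {(x, H). x \<in> carrier G \<and> subgroup H G}"
    using x normal_imp_subgroup[OF N(1)] by simp
  from tendsto_uniform_limitI[OF M[unfolded measures_index_uniformly_def] this]
  have "(\<lambda>n. measure (M n) (x <# N)) \<longlonglongrightarrow> inverse_index G N" by simp
  \<comment> \<open>Index measurement is stated for left cosets, while the quotient consists of
    right cosets.\<close>
  moreover have "x <# N = c" using normal.coset_eq[OF N(1)] x by simp
  moreover have "inverse_index G N = 1 / card (carrier (G Mod N))"
    using N(2) by (simp add: inverse_index_def FactGroup_def)
  ultimately show ?thesis by simp
qed

lemma tendsto_measure_coset_tuple_preimage:
  assumes N: "N \<lhd> G" "finite (carrier (G Mod N))" and M: "measures_index_uniformly G M"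
    and M_prob: "\<And>n. prob_measure_on G (M n)"
    and T: "T \<subseteq> {..<k} \<rightarrow>\<^sub>E carrier (G Mod N)"
  shows "(\<lambda>n. measure (power_measure k (M n)) (coset_tuple_preimage k G N T))
    \<longlonglongrightarrow> card T / card (carrier (G Mod N)) ^ k"
proof -
  have finT: "finite T" using N(2) by (intro finite_subset[OF T] finite_PiE) auto
  have "(\<lambda>n. \<Sum>q\<in>T. \<Prod>i<k. measure (M n) (q i))
      \<longlonglongrightarrow> (\<Sum>q\<in>T. \<Prod>i<k. 1 / card (carrier (G Mod N)))"
    using T by (intro tendsto_sum tendsto_prod tendsto_measure_coset[OF N M]) auto
  then show ?thesis
    by (simp add: measure_coset_tuple_preimage(2)[OF N(1) M_prob finT T] power_divide)
qed

end

section \<open>Convergence of the degrees of satisfiability\<close>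

context group
begin

lemma finite_carrier_Mod: "finite_index G N \<Longrightarrow> finite (carrier (G Mod N))"
  by (simp add: finite_index_def FactGroup_def)

text \<open>
  The sets of cosets of a finite-index subgroup \<open>N\<close> met by \<open>H m\<close> decrease, hence stabilise. From
  that point on every element of \<open>H m\<close> agrees with an element of \<open>N\<close> modulo \<open>H m'\<close>.
\<close>

lemma eventually_image_subset:
  fixes H :: "nat \<Rightarrow> 'a set"
  assumes N: "finite_index G N" and H: "\<And>m. H m \<lhd> G" "\<And>m m'. m \<le> m' \<Longrightarrow> H m' \<subseteq> H m"
  shows "\<exists>m0. \<forall>m\<ge>m0. \<forall>m'\<ge>m. (#>) (H m') ` H m \<subseteq> (#>) (H m') ` N"
proof -
  let ?S = "\<lambda>m. (#>) N ` H m"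
  have sub: "subgroup N G" and fin: "finite (rcosets N)"
    using N by (auto simp: finite_index_def)
  have HG: "x \<in> carrier G" if "x \<in> H m" for x m
    using subgroup.mem_carrier[OF normal_imp_subgroup[OF H(1)] that] .
  have "?S m \<subseteq> rcosets N" for m
    using HG by (auto simp: RCOSETS_def)
  then have finS: "finite (?S m)" for m
    using fin finite_subset by blast
  obtain m0 where m0: "\<And>m. card (?S m0) \<le> card (?S m)"
    using ex_has_least_nat[of "\<lambda>_. True" 0 "\<lambda>m. card (?S m)"] by auto
  have eq: "?S m = ?S m0" if "m0 \<le> m" for m
  proof (rule card_seteq[OF finS])
    show "?S m \<subseteq> ?S m0" using H(2)[OF that] by (rule image_mono)
  qed (rule m0)
  show ?thesis
  proof (intro exI allI impI subsetI)
    fix m m' c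
    assume m: "m0 \<le> m" "m \<le> m'" and c: "c \<in> (#>) (H m') ` H m"
    then obtain x where x: "x \<in> H m" "c = H m' #> x" by blast
    have "N #> x \<in> ?S m'" using x(1) eq[OF m(1)] eq[of m'] m by (metis image_eqI le_trans)
    then obtain y where y: "y \<in> H m'" "N #> x = N #> y" by blast
    have "x \<in> N #> y" using rcos_self[OF HG[OF x(1)] sub] y(2) by simp
    then obtain u where u: "u \<in> N" "x = u \<otimes> y" by (auto simp: r_coset_def)
    have uG: "u \<in> carrier G" using subgroup.mem_carrier[OF sub u(1)] .
    have "x \<in> u <# H m'" using u(2) y(1) by (auto simp: l_coset_def)
    then have "x \<in> H m' #> u" using normal.coset_eq[OF H(1)] uG by simp
    then have "c = H m' #> u" using r_coset_eq_iff[OF H(1) HG[OF x(1)] uG] x(2) by simp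
    then show "c \<in> (#>) (H m') ` N" using u(1) by blast
  qed
qed

text \<open>Beyond \<open>m0\<close> the image of \<open>H m\<close> lies in that of a nilpotent
  subgroup \<open>N\<close>, whose lower central series has a length independent of \<open>m\<close>
  and \<open>m'\<close>. One \<open>n\<close> for all pairs keeps the lost proportion bounded below
  as \<open>m\<close> grows.\<close>

lemma eventually_filtration:
  fixes H :: "nat \<Rightarrow> 'a set"
  assumes G: "virtually_nilpotent_group G"
    and H: "\<And>m. H m \<lhd> G" "\<And>m m'. m \<le> m' \<Longrightarrow> H m' \<subseteq> H m"
  obtains m0 n where "\<And>m m'. m0 \<le> m \<Longrightarrow> m \<le> m' \<Longrightarrow>
    \<exists>K. group_filtration (G Mod H m') K \<and> (#>) (H m') ` H m \<subseteq> K (Suc 0) \<and> K n = {\<one>\<^bsub>G Mod H m'\<^esub>}"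
proof -
  obtain N c where N: "finite_index G N" "group (G\<lparr>carrier := N\<rparr>)"
    and c: "lower_central_series (G\<lparr>carrier := N\<rparr>) c = {\<one>}"
    using G by (auto simp: virtually_nilpotent_group_def nilpotent_group_def)
  have NG: "N \<subseteq> carrier G"
    using N(1) subgroup.subset by (auto simp: finite_index_def)
  from eventually_image_subset[of N H, OF N(1) H]
  obtain m0 where m0: "\<forall>m\<ge>m0. \<forall>m'\<ge>m. (#>) (H m') ` H m \<subseteq> (#>) (H m') ` N" ..
  let ?L = "\<lambda>i. lower_central_series (G\<lparr>carrier := N\<rparr>) (i - 1)"
  show ?thesis
  \<comment> \<open>\<open>Suc c\<close>, because the filtration is the lower central series shifted
    by one.\<close>
  proof (rule that[of m0 "Suc c"])
    fix m m' assume m: "m0 \<le> m" "m \<le> m'"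
    interpret hom: group_hom G "G Mod H m'" "(#>) (H m')" by (rule group_hom_Mod[OF H(1)])
    have "(#>) (H m') \<in> hom (G\<lparr>carrier := N\<rparr>) (G Mod H m')"
      using NG by (intro homI) (simp_all add: subsetD[OF NG] del: mult_FactGroup)
    then have "group_hom (G\<lparr>carrier := N\<rparr>) (G Mod H m') ((#>) (H m'))"
      by (intro group_hom.intro group_hom_axioms.intro N(2) hom.H.is_group)
    from group_hom.filtration_image[OF this group.lower_central_series_filtration[OF N(2)]]
    have "group_filtration (G Mod H m') (\<lambda>i. (#>) (H m') ` ?L i)" .
    moreover have "(#>) (H m') ` H m \<subseteq> (#>) (H m') ` ?L (Suc 0)"
      using m0 m by simp
    moreover have "(#>) (H m') ` ?L (Suc c) = {\<one>\<^bsub>G Mod H m'\<^esub>}"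
      using hom.hom_one by (simp add: c)
    ultimately show "\<exists>K. group_filtration (G Mod H m') K \<and> (#>) (H m') ` H m \<subseteq> K (Suc 0) \<and>
        K (Suc c) = {\<one>\<^bsub>G Mod H m'\<^esub>}"
      by blast
  qed
qed

lemma sat_degree_word_class:
  assumes "w \<in> lists (letters k G)"
  shows "sat_degree k G (word_class k G w) \<mu> =
    measure (power_measure k \<mu>) {g \<in> {..<k} \<rightarrow>\<^sub>E carrier G. eval_word G g w = \<one>}"
proof -
  have "eval_equation G (word_class k G w) g = eval_word G g w"
    if "g \<in> {..<k} \<rightarrow>\<^sub>E carrier G" for g
    using that by (intro eval_equation_word_class[OF is_group _ assms]) (simp add: PiE_def)
  then show ?thesis
    unfolding sat_degree_def power_measure_def by (metis (mono_tags, lifting) Collect_cong)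
qed

definition solution_density :: "nat \<Rightarrow> 'a letter list \<Rightarrow> 'a set \<Rightarrow> real" where
  "solution_density k w N =
    card (quotient_solutions k G w N) / card (carrier (G Mod N)) ^ k"

lemma sat_degree_finite_quotient_equation:
  assumes N: "N \<lhd> G" "finite_index G N" and w: "w \<in> lists (letters k G)"
  shows "sat_degree_finite k (G Mod N) (quotient_equation k G N (word_class k G w)) =
    solution_density k w N"
proof -
  interpret hom: group_hom G "G Mod N" "(#>) N" by (rule group_hom_Mod[OF N(1)])
  have "quotient_equation k G N (word_class k G w) = word_class k (G Mod N) (map (map_letter ((#>) N)) w)"
    unfolding quotient_equation_def
    by (rule map_equation_word_class[OF is_group hom.H.is_group hom.homh w])
  moreover have w': "map (map_letter ((#>) N)) w \<in> lists (letters k (G Mod N))"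
    using w by (intro map_letter_in_letters) auto
  moreover have "carrier (G Mod N) \<noteq> {}" using hom.H.one_closed by blast
  ultimately show ?thesis
    unfolding sat_degree_finite_def solution_density_def quotient_solutions_eq[OF N(1) w]
    using finite_carrier_Mod[OF N(2)]
    by (simp only: hom.H.sat_degree_word_class[OF w'])
      (rule measure_power_uniform_count_measure, auto)
qed

end

theorem corollary1p16:
  fixes G :: "('a, 'b) monoid_scheme"
    and k :: nat
    and \<phi> :: "'a letter list set"
    and M :: "nat \<Rightarrow> 'a measure"
    and H :: "nat \<Rightarrow> 'a set"
  assumes "group G"
    and "finitely_generated_group G"
    and "virtually_nilpotent_group G"
    and "\<phi> \<in> carrier (free_product k G)"
    and "\<And>n. prob_measure_on G (M n)"
    and "measures_index_uniformly G M"
    and "\<And>m. H m \<lhd> G"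
    and "\<And>m. finite_index G (H m)"
    and "\<And>m. H (Suc m) \<subset> H m"
    and "(\<Inter>m. H m) = {\<one>\<^bsub>G\<^esub>}"
  shows "(\<lambda>m. ereal (sat_degree_finite k (G Mod H m) (quotient_equation k G (H m) \<phi>)))
           \<longlonglongrightarrow> sat_degree_seq k G \<phi> M"
proof -
  interpret group G by fact
  note M = assms(5,6) and H = assms(7,8)
  note fin = finite_carrier_Mod[OF H(2)]
  have H_mono: "H m' \<subseteq> H m" if "m \<le> m'" for m m'
    using lift_Suc_antimono_le[of H, OF psubset_imp_subset[OF assms(9)] that] .
  obtain w where w: "w \<in> lists (letters k G)" "\<phi> = word_class k G w"
    using assms(4) by (auto simp: free_product_def)
  define Z where "Z = {g \<in> {..<k} \<rightarrow>\<^sub>E carrier G. eval_word G g w = \<one>\<^bsub>G\<^esub>}"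
  define S where "S m = quotient_solutions k G w (H m)" for m
  define C where "C m = coset_solutions k G w (H m)" for m
  define q where "q m = real (card (carrier (G Mod H m)) ^ k)" for m
  define d where "d m = card (S m) / q m" for m
  define \<nu> where "\<nu> n = power_measure k (M n)" for n
  define l where "l = sat_degree_seq k G \<phi> M"
  have l: "l = limsup (\<lambda>n. ereal (measure (\<nu> n) Z))"
    unfolding l_def sat_degree_seq_def w(2) sat_degree_word_class[OF w(1)] Z_def \<nu>_def ..
  have S_subset: "S m \<subseteq> {..<k} \<rightarrow>\<^sub>E carrier (G Mod H m)" for m
    unfolding S_def quotient_solutions_eq[OF H(1) w(1)] by (rule Collect_restrict)
  have C_subset: "C m \<subseteq> S m" for m
    unfolding C_def S_def by (rule coset_solutions_subset[OF H(1) w(1)])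
  have finS: "finite (S m)" for m
    using fin by (intro finite_subset[OF S_subset] finite_PiE) auto
  have finC: "finite (C m)" for m
    by (rule finite_subset[OF C_subset finS])
  have q_pos: "q m > 0" for m
  proof -
    have "carrier (G Mod H m) \<noteq> {}" by (auto simp: carrier_FactGroup)
    then show ?thesis using fin by (simp add: q_def card_gt_0_iff)
  qed
  have dq: "d m * q m = card (S m)" for m
    using q_pos[of m] by (simp add: d_def)
  have prob: "prob_space (\<nu> n)" for n
    using M(1)[of n] unfolding \<nu>_def prob_measure_on_def by (blast intro: prob_space_power_measure)
  \<comment> \<open>Finite generation gives countability, and with it measurability of
    \<open>Z\<close>.\<close>
  have countable: "countable (carrier G)"
    using assms(2) countable_generate countable_finite unfolding finitely_generated_group_def by metis
  have Z_sets: "Z \<in> sets (\<nu> n)" for n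
    unfolding \<nu>_def using M(1)[of n] countable
    by (intro sets_power_measure_countable) (auto simp: prob_measure_on_def Z_def)
  note \<nu>_mono = finite_measure.finite_measure_mono[OF prob_space.finite_measure[OF prob]]
  have preimage_sets: "coset_tuple_preimage k G (H m) (S m) \<in> sets (\<nu> n)" for m n
    unfolding \<nu>_def by (rule measure_coset_tuple_preimage(1)[OF H(1) M(1) finS S_subset])
  have lim_S: "(\<lambda>n. measure (\<nu> n) (coset_tuple_preimage k G (H m) (S m))) \<longlonglongrightarrow> d m" for m
    using tendsto_measure_coset_tuple_preimage[OF H(1) fin M(2,1) S_subset]
    by (simp add: \<nu>_def d_def q_def)
  have lim_C: "(\<lambda>n. measure (\<nu> n) (coset_tuple_preimage k G (H m) (C m))) \<longlonglongrightarrow> card (C m) / q m" for m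
    using tendsto_measure_coset_tuple_preimage[OF H(1) fin M(2,1) order.trans[OF C_subset S_subset]]
    by (simp add: \<nu>_def q_def)
  have pre_S: "g \<in> coset_tuple_preimage k G (H m) (S m) \<longleftrightarrow>
      g \<in> {..<k} \<rightarrow>\<^sub>E carrier G \<and> eval_word G g w \<in> H m" for g m
    using coset_tuple_in_quotient_solutions_iff[OF H(1) _ w(1)]
    by (auto simp: coset_tuple_preimage_def S_def)

  \<comment> \<open>A solution in \<open>G\<close> is a solution modulo every
    \<open>H m\<close>.\<close>
  have upper: "l \<le> ereal (d m)" for m
  proof -
    have "Z \<subseteq> coset_tuple_preimage k G (H m) (S m)"
      using pre_S subgroup.one_closed[OF normal_imp_subgroup[OF H(1)]] by (auto simp: Z_def)
    then have "measure (\<nu> n) Z \<le> measure (\<nu> n) (coset_tuple_preimage k G (H m) (S m))" for n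
      by (rule \<nu>_mono[OF _ preimage_sets])
    then have "l \<le> limsup (\<lambda>n. ereal (measure (\<nu> n) (coset_tuple_preimage k G (H m) (S m))))"
      unfolding l by (intro Limsup_mono) simp
    also have "\<dots> = ereal (d m)"
      using lim_S by (intro lim_imp_Limsup) simp_all
    finally show ?thesis .
  qed
  \<comment> \<open>The blocks in \<open>C m\<close> consist of solutions, and their measures
    converge, so their limit bounds the limit superior from below.\<close>
  have lower: "ereal (card (C m) / q m) \<le> l" for m
  proof -
    have "coset_tuple_preimage k G (H m) (C m) \<subseteq> Z"
    proof
      fix g assume "g \<in> coset_tuple_preimage k G (H m) (C m)"
      then have g: "g \<in> {..<k} \<rightarrow>\<^sub>E carrier G" "coset_tuple k G (H m) g \<in> C m"
        by (auto simp: coset_tuple_preimage_def)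
      have "\<forall>i<k. g i \<in> coset_tuple k G (H m) g i"
        using coset_tuple_eq_iff[OF H(1) g(1) coset_tuple_in[OF g(1)]] by simp
      then show "g \<in> Z" using g by (simp add: C_def coset_solutions_def Z_def)
    qed
    then have "measure (\<nu> n) (coset_tuple_preimage k G (H m) (C m)) \<le> measure (\<nu> n) Z" for n
      by (rule \<nu>_mono[OF _ Z_sets])
    then have "limsup (\<lambda>n. ereal (measure (\<nu> n) (coset_tuple_preimage k G (H m) (C m)))) \<le> l"
      unfolding l by (intro Limsup_mono) simp
    moreover have "limsup (\<lambda>n. ereal (measure (\<nu> n) (coset_tuple_preimage k G (H m) (C m)))) =
        ereal (card (C m) / q m)"
      using lim_C by (intro lim_imp_Limsup) simp_all
    ultimately show ?thesis by simp
  qed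

  \<comment> \<open>Monotonicity is read off from the measures: the preimages are nested, and
    \<open>d m\<close> is the limit of their measures along \<open>M\<close>.\<close>
  have "decseq d"
    unfolding decseq_def
  proof (intro allI impI)
    fix m m' :: nat assume "m \<le> m'"
    then have "coset_tuple_preimage k G (H m') (S m') \<subseteq> coset_tuple_preimage k G (H m) (S m)"
      using H_mono[of m m'] by (auto simp: pre_S)
    then have "measure (\<nu> n) (coset_tuple_preimage k G (H m') (S m')) \<le>
        measure (\<nu> n) (coset_tuple_preimage k G (H m) (S m))" for n
      by (rule \<nu>_mono[OF _ preimage_sets])
    then show "d m' \<le> d m"
      by (intro LIMSEQ_le[OF lim_S lim_S]) blast
  qed
  moreover have "0 \<le> d m" for m using q_pos[of m] by (simp add: d_def)
  ultimately obtain D where D: "d \<longlonglongrightarrow> D" "\<And>m. D \<le> d m"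
    using decseq_convergent[of d 0] by blast

  from eventually_filtration[of H, OF assms(3) H(1) H_mono]
  obtain m0 n where filt: "\<And>m m'. m0 \<le> m \<Longrightarrow> m \<le> m' \<Longrightarrow> \<exists>K. group_filtration (G Mod H m') K \<and>
      (#>\<^bsub>G\<^esub>) (H m') ` H m \<subseteq> K (Suc 0) \<and> K n = {\<one>\<^bsub>G Mod H m'\<^esub>}"
    by metis
  have gap: "d m - 2 ^ n * (d m - D) \<le> card (C m) / q m" if m: "m0 \<le> m" for m
  proof -
    \<comment> \<open>A block outside \<open>C m\<close> contains a tuple with nontrivial value; as
      the \<open>H m\<close> intersect trivially, some \<open>H m'\<close> omits that value.\<close>
    have "\<exists>m'. \<exists>g \<in> {..<k} \<rightarrow>\<^sub>E carrier G. coset_tuple k G (H m) g = c \<and> eval_word G g w \<notin> H m'"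
      if c: "c \<in> S m - C m" for c
    proof -
      have cE: "c \<in> {..<k} \<rightarrow>\<^sub>E carrier (G Mod H m)" using c S_subset by blast
      then obtain g where g: "g \<in> {..<k} \<rightarrow>\<^sub>E carrier G" "\<forall>i<k. g i \<in> c i" "eval_word G g w \<noteq> \<one>\<^bsub>G\<^esub>"
        using c by (auto simp: C_def coset_solutions_def)
      have "\<exists>m'. eval_word G g w \<notin> H m'" using assms(10) g(3) by blast
      then show ?thesis using g coset_tuple_eq_iff[OF H(1) g(1) cE] by blast
    qed
    then obtain f where f: "\<And>c. c \<in> S m - C m \<Longrightarrow> \<exists>g \<in> {..<k} \<rightarrow>\<^sub>E carrier G.
        coset_tuple k G (H m) g = c \<and> eval_word G g w \<notin> H (f c)"
      by metis
    \<comment> \<open>Finitely many blocks are in question, so one deeper level exposes all of them.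
      Inserting \<open>m\<close> gives \<open>m \<le> m'\<close> and keeps the maximum defined when
      there are none.\<close>
    define m' where "m' = Max (insert m (f ` (S m - C m)))"
    have mm': "m \<le> m'" unfolding m'_def using finS by (intro Max_ge) auto
    have fm': "f c \<le> m'" if "c \<in> S m - C m" for c
      unfolding m'_def using finS that by (intro Max_ge) auto
    obtain K where K: "group_filtration (G Mod H m') K" "(#>\<^bsub>G\<^esub>) (H m') ` H m \<subseteq> K (Suc 0)"
      "K n = {\<one>\<^bsub>G Mod H m'\<^esub>}"
      using filt[OF m mm'] by blast
    let ?a = "real (card ((#>\<^bsub>G\<^esub>) (H m') ` H m) ^ k)"
    have qa: "q m' = q m * ?a"
      unfolding q_def using card_coset_tuples[OF H(1) H(1) H_mono[OF mm'] fin fin, of k]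
      by (simp only: of_nat_mult)
    define e where "e = card (C m) / q m"
    have eC: "real (card (C m)) = e * q m"
      using q_pos[of m] by (simp add: e_def)
    have "card (S m') * 2 ^ n + card (S m - C m) * card ((#>\<^bsub>G\<^esub>) (H m') ` H m) ^ k \<le>
        card (S m) * card ((#>\<^bsub>G\<^esub>) (H m') ` H m) ^ k * 2 ^ n"
      unfolding S_def C_def
    proof (rule card_quotient_solutions_le[OF H(1) H(1) H_mono[OF mm'] fin fin w(1) K])
      fix c assume "c \<in> quotient_solutions k G w (H m)" "c \<notin> coset_solutions k G w (H m)"
      then have c: "c \<in> S m - C m" by (simp add: S_def C_def)
      show "\<exists>g\<in>{..<k} \<rightarrow>\<^sub>E carrier G. coset_tuple k G (H m) g = c \<and> eval_word G g w \<notin> H m'"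
        using f[OF c] H_mono[OF fm'[OF c]] by blast
    qed
    from of_nat_mono[where 'a = real, OF this]
    have "real (card (S m')) * 2 ^ n + real (card (S m - C m)) * ?a \<le>
        real (card (S m)) * ?a * 2 ^ n"
      by simp
    moreover have "real (card (S m - C m)) = real (card (S m)) - real (card (C m))"
      using card_Diff_subset[OF finC C_subset] card_mono[OF finS C_subset] by (simp add: of_nat_diff)
    ultimately have "d m' * q m' * 2 ^ n + (d m * q m - card (C m)) * ?a \<le> d m * q m * ?a * 2 ^ n"
      by (simp only: dq)
    \<comment> \<open>Cancelling \<open>q m'\<close> turns the count into an inequality between
      densities, from which \<open>D \<le> d m'\<close> then removes \<open>m'\<close>.\<close>
    then have "(d m' * 2 ^ n + (d m - e)) * q m' \<le> (d m * 2 ^ n) * q m'"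
      unfolding qa eC by (simp add: algebra_simps)
    then have "d m' * 2 ^ n + (d m - e) \<le> d m * 2 ^ n"
      using q_pos[of m'] by (rule mult_right_le_imp_le)
    moreover have "D * 2 ^ n \<le> d m' * 2 ^ n" using D(2) by simp
    moreover have "2 ^ n * (d m - D) = d m * 2 ^ n - D * 2 ^ n" by (simp add: algebra_simps)
    ultimately show ?thesis unfolding e_def by linarith
  qed

  have "l \<le> ereal D"
    using D(1) upper by (intro tendsto_lowerbound[of "\<lambda>m. ereal (d m)"]) auto
  moreover have "ereal D \<le> l"
  proof (rule tendsto_upperbound)
    \<comment> \<open>Since \<open>n\<close> does not depend on \<open>m\<close>, the correction
      term tends to 0.\<close>
    have "(\<lambda>m. d m - 2 ^ n * (d m - D)) \<longlonglongrightarrow> D - 2 ^ n * (D - D)"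
      by (intro tendsto_intros D(1))
    then show "(\<lambda>m. ereal (d m - 2 ^ n * (d m - D))) \<longlonglongrightarrow> ereal D" by simp
    show "\<forall>\<^sub>F m in sequentially. ereal (d m - 2 ^ n * (d m - D)) \<le> l"
      using eventually_ge_at_top[of m0]
    proof eventually_elim
      case (elim m)
      then show ?case using gap[OF elim] lower[of m] by (meson ereal_less_eq(3) order.trans)
    qed
  qed simp
  ultimately have "l = ereal D" by (rule antisym)
  moreover have "sat_degree_finite k (G Mod H m) (quotient_equation k G (H m) \<phi>) = d m" for m
    unfolding w(2) sat_degree_finite_quotient_equation[OF H w(1)]
    by (simp add: solution_density_def d_def S_def q_def)
  ultimately show ?thesis
    using D(1) by (simp add: l_def)
qed

end
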